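(* Consider the control-affine system $\dot{\mathbf x}=\mathbf f(\mathbf x)+\mathbf g(\mathbf x)\mathbf u$ with $\mathbf x\in\mathbb R^n$, $\mathbf u\in\mathbb R^m$, and smooth $\mathbf f:\mathbb R^n\to\mathbb R^n$, $\mathbf g:\mathbb R^n\to\mathbb R^{n\times m}$. Let $\mathbf H:\mathbb R^n\to\mathbb S^p$ be smooth, with associated functions $\boldsymbol\Psi_1,\dots,\boldsymbol\Psi_r$ as defined in the context. Let $\mathbf x\in\mathbb R^n$ and let $\mathbf V_r(\mathbf x)$ be a matrix whose columns form an orthonormal basis of the eigenspace of $\boldsymbol\Psi_r(\mathbf x)$ associated with its smallest eigenvalue $\lambda_{\min}(\boldsymbol\Psi_r(\mathbf x))$. If there exists an index $j^*\in\{1,\dots,m\}$ such that the matrix $$\mathbf V_r(\mathbf x)^\top\,\mathbf L_{\mathbf g_{j^*}}\boldsymbol\Psi_r(\mathbf x)\,\mathbf V_r(\mathbf x)$$ is either positive definite or negative definite, then $\mathbf H$ has matrix relative degree $r$ at $\mathbf x$.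
   Context: $\mathbb S^p$ is the set of real symmetric $p\times p$ matrices; $\succ$ denotes the positive definite ordering. $\mathbf g_j$ is the $j$-th column of $\mathbf g$. Matrix Lie derivative: for a differentiable $\mathbf A:\mathbb R^n\to\mathbb S^p$ and a vector field $\mathbf w$, $\mathbf L_{\mathbf w}\mathbf A(\mathbf x)$ is the matrix with entries $\nabla A_{ij}(\mathbf x)^\top\mathbf w(\mathbf x)$; $\mathbf L_{\mathbf f}^k$ denotes the $k$-fold iterate. Extended class-$\mathcal K^e$ function: a continuous, strictly increasing $\alpha:\mathbb R\to\mathbb R$ with $\alpha(0)=0$. Its spectral extension $\boldsymbol\alpha:\mathbb S^p\to\mathbb S^p$ is $\boldsymbol\alpha(Q\,\mathrm{diag}(\lambda_1,\dots,\lambda_p)Q^\top)=Q\,\mathrm{diag}(\alpha(\lambda_1),\dots,\alpha(\lambda_p))Q^\top$ for $Q$ orthogonal. Recursive functions: given smooth extended class-$\mathcal K^e$ functions $\alpha_1,\dots,\alpha_{r-1}$, set $\boldsymbol\Psi_1=\mathbf H$ and $\boldsymbol\Psi_{i+1}(\mathbf x)=\mathbf L_{\mathbf f}\boldsymbol\Psi_i(\mathbf x)+\boldsymbol\alpha_i(\boldsymbol\Psi_i(\mathbf x))$ for $i\in\{1,\dots,r-1\}$. The integer $r\ge1$ is the first level at which the input appears: $\mathbf L_{\mathbf g_j}\boldsymbol\Psi_i\equiv\mathbf 0$ on $\mathbb R^n$ for all $j\in\{1,\dots,m\}$ and $i<r$, while $\mathbf L_{\mathbf g_j}\boldsymbol\Psi_r\not\equiv\mathbf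 0$ for some $j$. Matrix relative degree: $\mathbf H$ has matrix relative degree $r$ (with respect to $\mathbf u$) at $\mathbf x$ if (1) $\mathbf L_{\mathbf g_j}\mathbf L_{\mathbf f}^k\mathbf H(\mathbf x)=\mathbf 0$ for each $j\in\{1,\dots,m\}$ and each $k\in\{0,\dots,r-2\}$; and (2) there exists $\mathbf u\in\mathbb R^m$ such that $\mathbf V_r(\mathbf x)^\top\big(\sum_{j=1}^m\mathbf L_{\mathbf g_j}\mathbf L_{\mathbf f}^{r-1}\mathbf H(\mathbf x)\,u_j\big)\mathbf V_r(\mathbf x)\succ\mathbf 0$, where $\mathbf V_r(\mathbf x)$ has as columns an orthonormal basis of the eigenspace of $\boldsymbol\Psi_r(\mathbf x)$ for its smallest eigenvalue. *)

theory Defs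
  imports "HOL-Analysis.Analysis"
begin

section \<open>Smooth maps\<close>

text \<open>
  \<open>Ck_map k f\<close>: all iterated directional derivatives of order at most \<open>k\<close> exist (as Frechet
  derivatives) and are continuous, i.e. \<open>f\<close> is of class \<open>C\<^sup>k\<close> on the whole space.
\<close>

primrec Ck_map :: "nat \<Rightarrow> ('a::euclidean_space \<Rightarrow> 'b::real_normed_vector) \<Rightarrow> bool" where
  "Ck_map 0 f \<longleftrightarrow> continuous_on UNIV f"
| "Ck_map (Suc k) f \<longleftrightarrow>
     (\<forall>x. f differentiable at x) \<and> (\<forall>v. Ck_map k (\<lambda>x. frechet_derivative f (at x) v))"

definition smooth_map :: "('a::euclidean_space \<Rightarrow> 'b::real_normed_vector) \<Rightarrow> bool" where
  "smooth_map f \<longleftrightarrow> (\<forall>k. Ck_map k f)"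


section \<open>Symmetric matrices\<close>

definition symmetric_mat :: "real^'p^'p \<Rightarrow> bool" where
  "symmetric_mat A \<longleftrightarrow> transpose A = A"

definition pos_def_mat :: "real^'p^'p \<Rightarrow> bool" where
  "pos_def_mat A \<longleftrightarrow> symmetric_mat A \<and> (\<forall>v. v \<noteq> 0 \<longrightarrow> v \<bullet> (A *v v) > 0)"

definition neg_def_mat :: "real^'p^'p \<Rightarrow> bool" where
  "neg_def_mat A \<longleftrightarrow> symmetric_mat A \<and> (\<forall>v. v \<noteq> 0 \<longrightarrow> v \<bullet> (A *v v) < 0)"

definition eigenspace :: "real^'p^'p \<Rightarrow> real \<Rightarrow> (real^'p) set" where
  "eigenspace A c = {v. A *v v = c *\<^sub>R v}"

definition eigenvalues :: "real^'p^'p \<Rightarrow> real set" where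
  "eigenvalues A = {c. \<exists>v. v \<noteq> 0 \<and> A *v v = c *\<^sub>R v}"

definition lambda_min :: "real^'p^'p \<Rightarrow> real" where
  "lambda_min A = Min (eigenvalues A)"

text \<open>
  The number of columns of \<open>V\<close> is the cardinality of the index type \<open>'d\<close>; the condition forces it
  to be the multiplicity of the smallest eigenvalue of \<open>A\<close>.
\<close>

definition min_eigenbasis :: "real^'p^'p \<Rightarrow> real^'d^'p \<Rightarrow> bool" where
  "min_eigenbasis A V \<longleftrightarrow>
     (\<forall>i j. column i V \<bullet> column j V = (if i = j then 1 else 0)) \<and>
     span (columns V) = eigenspace A (lambda_min A)"

definition diag_mat :: "real^'p \<Rightarrow> real^'p^'p" where
  "diag_mat d = (\<chi> i j. if i = j then d $ i else 0)"


section \<open>Extended class-K functions and their spectral extension\<close>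

definition extended_class_K :: "(real \<Rightarrow> real) \<Rightarrow> bool" where
  "extended_class_K \<alpha> \<longleftrightarrow> continuous_on UNIV \<alpha> \<and> strict_mono \<alpha> \<and> \<alpha> 0 = 0"

text \<open>Only meaningful for symmetric \<open>A\<close>; see \<open>spectral_ext_eq\<close> for well-definedness.\<close>

definition spectral_ext :: "(real \<Rightarrow> real) \<Rightarrow> real^'p^'p \<Rightarrow> real^'p^'p" where
  "spectral_ext \<alpha> A = (THE B. \<exists>Q d. orthogonal_matrix Q \<and>
     A = Q ** diag_mat d ** transpose Q \<and>
     B = Q ** diag_mat (\<chi> i. \<alpha> (d $ i)) ** transpose Q)"

lemma matrix_mult_diag:
  "P ** diag_mat d = (\<chi> i j. P $ i $ j * d $ j)"
  "diag_mat d ** P = (\<chi> i j. d $ i * P $ i $ j)"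
  by (simp_all add: matrix_matrix_mult_def diag_mat_def vec_eq_iff if_distrib if_distribR
      cong: if_cong)

lemma spectral_ext_unique:
  fixes Q R :: "real^'p^'p"
  assumes Q: "orthogonal_matrix Q" and R: "orthogonal_matrix R"
    and eq: "Q ** diag_mat d ** transpose Q = R ** diag_mat e ** transpose R"
  shows "Q ** diag_mat (\<chi> i. \<alpha> (d $ i)) ** transpose Q =
         R ** diag_mat (\<chi> i. \<alpha> (e $ i)) ** transpose R"
proof -
  define P where "P = transpose R ** Q"
  have QQ: "transpose Q ** Q = mat 1" "Q ** transpose Q = mat 1"
    and RR: "transpose R ** R = mat 1" "R ** transpose R = mat 1"
    using Q R by (auto simp: orthogonal_matrix_def)
  have "P ** diag_mat d = transpose R ** (Q ** diag_mat d ** transpose Q) ** Q"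
    by (metis P_def QQ(1) matrix_mul_assoc matrix_mul_rid)
  also have "\<dots> = diag_mat e ** P"
    unfolding eq by (metis P_def RR(1) matrix_mul_assoc matrix_mul_lid)
  finally have "P $ i $ j * d $ j = e $ i * P $ i $ j" for i j
    by (simp add: matrix_mult_diag vec_eq_iff)
  then have "P $ i $ j * \<alpha> (d $ j) = \<alpha> (e $ i) * P $ i $ j" for i j
    by (cases "P $ i $ j = 0") (simp, metis mult.commute mult_cancel_left)
  then have PD: "P ** diag_mat (\<chi> i. \<alpha> (d $ i)) = diag_mat (\<chi> i. \<alpha> (e $ i)) ** P"
    by (simp add: matrix_mult_diag vec_eq_iff)
  have "Q ** diag_mat (\<chi> i. \<alpha> (d $ i)) ** transpose Q =
        R ** (P ** diag_mat (\<chi> i. \<alpha> (d $ i))) ** transpose Q"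
    by (metis P_def RR(2) matrix_mul_assoc matrix_mul_lid)
  also have "\<dots> = R ** diag_mat (\<chi> i. \<alpha> (e $ i)) ** transpose R"
    unfolding PD by (metis P_def QQ(2) matrix_mul_assoc matrix_mul_rid)
  finally show ?thesis .
qed

lemma spectral_ext_eq:
  assumes "orthogonal_matrix Q"
  shows "spectral_ext \<alpha> (Q ** diag_mat d ** transpose Q) =
         Q ** diag_mat (\<chi> i. \<alpha> (d $ i)) ** transpose Q"
  unfolding spectral_ext_def
proof (rule the_equality)
  show "\<exists>R e. orthogonal_matrix R \<and>
      Q ** diag_mat d ** transpose Q = R ** diag_mat e ** transpose R \<and>
      Q ** diag_mat (\<chi> i. \<alpha> (d $ i)) ** transpose Q =
      R ** diag_mat (\<chi> i. \<alpha> (e $ i)) ** transpose R"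
    using assms by (intro exI[of _ Q] exI[of _ d]) simp
qed (elim exE conjE, simp only: spectral_ext_unique[OF assms])


section \<open>Matrix Lie derivatives and the recursive functions\<close>

text \<open>
  The Frechet derivative of the scalar function \<open>A\<^sub>i\<^sub>j\<close> at \<open>x\<close>, applied to \<open>w x\<close>, is the inner
  product of the gradient of \<open>A\<^sub>i\<^sub>j\<close> at \<open>x\<close> with \<open>w x\<close>.
\<close>

definition lie_deriv ::
    "(real^'n \<Rightarrow> real^'n) \<Rightarrow> (real^'n \<Rightarrow> real^'p^'p) \<Rightarrow> real^'n \<Rightarrow> real^'p^'p" where
  "lie_deriv w A x = (\<chi> i j. frechet_derivative (\<lambda>y. A y $ i $ j) (at x) (w x))"

text \<open>The recursion starts at index 1; the value at index 0 is a dummy.\<close>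

fun Psi :: "(real^'n \<Rightarrow> real^'n) \<Rightarrow> (nat \<Rightarrow> real \<Rightarrow> real) \<Rightarrow> (real^'n \<Rightarrow> real^'p^'p) \<Rightarrow>
    nat \<Rightarrow> real^'n \<Rightarrow> real^'p^'p" where
  "Psi f \<alpha> H 0 = H"
| "Psi f \<alpha> H (Suc 0) = H"
| "Psi f \<alpha> H (Suc (Suc k)) =
     (\<lambda>x. lie_deriv f (Psi f \<alpha> H (Suc k)) x + spectral_ext (\<alpha> (Suc k)) (Psi f \<alpha> H (Suc k) x))"


section \<open>Matrix relative degree\<close>

text \<open>
  \<open>k + 1 < r\<close> expresses \<open>k \<in> {0..r-2}\<close> without truncated subtraction. The argument \<open>V\<close> is the
  matrix \<open>V\<^sub>r(x)\<close> of the second condition; the property does not depend on its choice, see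
  \<open>has_matrix_relative_degree_indep\<close>.
\<close>

definition has_matrix_relative_degree ::
    "(real^'n \<Rightarrow> real^'n) \<Rightarrow> (real^'n \<Rightarrow> real^'m^'n) \<Rightarrow> (nat \<Rightarrow> real \<Rightarrow> real) \<Rightarrow>
     (real^'n \<Rightarrow> real^'p^'p) \<Rightarrow> nat \<Rightarrow> real^'n \<Rightarrow> real^'d^'p \<Rightarrow> bool" where
  "has_matrix_relative_degree f g \<alpha> H r x V \<longleftrightarrow>
     (\<forall>j k. k + 1 < r \<longrightarrow> lie_deriv (\<lambda>y. column j (g y)) ((lie_deriv f ^^ k) H) x = 0) \<and>
     min_eigenbasis (Psi f \<alpha> H r x) V \<and>
     (\<exists>u :: real^'m. pos_def_mat (transpose V **
        (\<Sum>j\<in>UNIV. u $ j *\<^sub>R lie_deriv (\<lambda>y. column j (g y)) ((lie_deriv f ^^ (r - 1)) H) x)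
        ** V))"

lemma min_eigenbasis_factor:
  fixes A :: "real^'p^'p" and V :: "real^'d^'p" and W :: "real^'e^'p"
  assumes V: "min_eigenbasis A V" and W: "min_eigenbasis A W"
  obtains Q :: "real^'e^'d" where "W = V ** Q" "\<And>z. Q *v z = 0 \<Longrightarrow> z = 0"
proof -
  have orth: "transpose V ** V = mat 1" "transpose W ** W = mat 1"
    using V W
    by (simp_all add: min_eigenbasis_def matrix_matrix_mult_def transpose_def mat_def
        vec_eq_iff column_def inner_vec_def)
  have "V *v (transpose V *v w) = w" if "w \<in> span (columns V)" for w
    using that
  proof (induction rule: span_induct)
    case base
    show ?case
      by (auto simp: subspace_def matrix_vector_right_distrib matrix_vector_mult_scaleR
          simp del: transpose_matrix_vector)
  next
    case (step w)
    then obtain j where "w = column j V" by (auto simp: columns_def)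
    then have "w = V *v axis j 1" by (simp add: matrix_vector_mult_basis)
    then have "transpose V *v w = axis j 1"
      by (simp add: matrix_vector_mul_assoc orth)
    then show ?case using \<open>w = V *v axis j 1\<close> by simp
  qed
  moreover have "W *v z \<in> span (columns V)" for z
    using V W matrix_vector_mult_in_columnspace[of W z] by (simp add: min_eigenbasis_def)
  ultimately have "V *v (transpose V *v (W *v z)) = W *v z" for z by blast
  then have eq: "W = V ** (transpose V ** W)"
    by (simp add: matrix_eq flip: matrix_vector_mul_assoc)
  have "z = 0" if "(transpose V ** W) *v z = 0" for z
  proof -
    have "W *v z = 0" using eq that by (metis matrix_vector_mul_assoc matrix_vector_mult_0_right)
    then show "z = 0"
      by (metis orth(2) matrix_vector_mul_assoc matrix_vector_mul_lid matrix_vector_mult_0_right)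
  qed
  with eq show thesis by (rule that)
qed

lemma pos_def_mat_congruence:
  fixes N :: "real^'d^'d" and Q :: "real^'e^'d"
  assumes N: "pos_def_mat N" and inj: "\<And>z. Q *v z = 0 \<Longrightarrow> z = 0"
  shows "pos_def_mat (transpose Q ** N ** Q)"
proof -
  have "z \<bullet> ((transpose Q ** N ** Q) *v z) = (Q *v z) \<bullet> (N *v (Q *v z))" for z
    by (simp add: inner_commute[of z] dot_lmul_matrix inner_commute[of "N *v _"]
        flip: matrix_vector_mul_assoc)
  then show ?thesis
    using N inj by (auto simp: pos_def_mat_def symmetric_mat_def matrix_transpose_mul matrix_mul_assoc)
qed

lemma has_matrix_relative_degree_indep:
  fixes V :: "real^'d^'p" and W :: "real^'e^'p"
  assumes "has_matrix_relative_degree f g \<alpha> H r x V" and W: "min_eigenbasis (Psi f \<alpha> H r x) W"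
  shows "has_matrix_relative_degree f g \<alpha> H r x W"
proof -
  have "min_eigenbasis (Psi f \<alpha> H r x) V"
    using assms(1) by (simp add: has_matrix_relative_degree_def)
  then obtain Q :: "real^'e^'d" where Q: "W = V ** Q" "\<And>z. Q *v z = 0 \<Longrightarrow> z = 0"
    using W min_eigenbasis_factor by blast
  have "pos_def_mat (transpose W ** M ** W)" if "pos_def_mat (transpose V ** M ** V)" for M
    using pos_def_mat_congruence[OF that Q(2)]
    by (simp add: Q(1) matrix_transpose_mul matrix_mul_assoc)
  then show ?thesis
    using assms unfolding has_matrix_relative_degree_def by blast
qed

end

(*
  Let N(s) be the set of smooth real functions phi on R^n with L_g L_f^k phi = 0 for all k < s and
  all columns g.  By the Leibniz rule N(s) is an algebra, and by the chain rule it is closed under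
  phi |-> F(phi) for smooth F.  Since L_f Psi_i = Psi_(i+1) - alpha_i(Psi_i), induction on s shows
  that the entries of Psi_i lie in N(r - i), so those of alpha_i(Psi_i) do as well.  For i = 1 this is
  the first condition, and peeling off the terms alpha_i(Psi_i) one by one gives
  L_g L_f^(r-1) H = L_g Psi_r, so u can be taken to be plus or minus a unit vector.

  The analytic input is that the spectral extension of a smooth function a is smooth.  Iterated
  Bernstein approximation gives polynomials p_n of degree n converging to a on bounded intervals
  faster than any power of n; the matrix polynomials p_n(A) then converge at the same rate on bounded
  sets of symmetric matrices, and by a Markov-type inequality each directional derivative costs only
  a factor O(n^2), so the telescoping series of the p_n(A) may be differentiated term by term.
*)

theory Submission
  imports Defs "HOL-Complex_Analysis.Complex_Analysis"
begin

section \<open>Calculus of smooth maps\<close>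

lemma Ck_map_SucD: "Ck_map (Suc k) f \<Longrightarrow> Ck_map k f"
proof (induction k arbitrary: f)
  case 0
  then show ?case
    by (auto intro!: differentiable_imp_continuous_on simp: differentiable_on_def
        intro: differentiable_at_withinI)
next
  case (Suc k)
  then show ?case by (metis Ck_map.simps(2))
qed

lemma frechet_derivative_add:
  assumes "f differentiable at x" "g differentiable at x"
  shows "frechet_derivative (\<lambda>x. f x + g x) (at x) v =
    frechet_derivative f (at x) v + frechet_derivative g (at x) v"
  using frechet_derivative_at[OF has_derivative_add[OF assms[unfolded frechet_derivative_works]]]
  by (metis)

lemma frechet_derivative_mult:
  fixes f g :: "'a::real_normed_vector \<Rightarrow> real"
  assumes "f differentiable at x" "g differentiable at x"
  shows "frechet_derivative (\<lambda>x. f x * g x) (at x) v =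
    f x * frechet_derivative g (at x) v + frechet_derivative f (at x) v * g x"
  using frechet_derivative_at[OF has_derivative_mult[OF assms[unfolded frechet_derivative_works]]]
  by (metis)

lemma frechet_derivative_bounded_linear:
  assumes "bounded_linear l" "f differentiable at x"
  shows "frechet_derivative (\<lambda>x. l (f x)) (at x) v = l (frechet_derivative f (at x) v)"
  using frechet_derivative_at[OF bounded_linear.has_derivative[OF assms(1)
      assms(2)[unfolded frechet_derivative_works]]]
  by (metis)

lemma frechet_derivative_basis:
  fixes f :: "'a::euclidean_space \<Rightarrow> 'b::real_normed_vector"
  assumes "f differentiable at x"
  shows "frechet_derivative f (at x) v =
    (\<Sum>b\<in>Basis. (v \<bullet> b) *\<^sub>R frechet_derivative f (at x) b)"
proof -
  interpret linear "frechet_derivative f (at x)"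
    using assms by (rule linear_frechet_derivative)
  show ?thesis
    by (subst euclidean_representation[symmetric, of v]) (simp only: sum scale)
qed

lemma differentiable_componentwise_at:
  "\<Phi> differentiable at x" if "\<And>b. b \<in> Basis \<Longrightarrow> (\<lambda>x. \<Phi> x \<bullet> b) differentiable at x"
  using that by (subst differentiable_componentwise_within) auto

lemma frechet_derivative_compose_basis:
  fixes F :: "'b::euclidean_space \<Rightarrow> real" and \<Phi> :: "'a::real_normed_vector \<Rightarrow> 'b"
  assumes F: "F differentiable at (\<Phi> x)"
    and \<Phi>: "\<And>b. b \<in> Basis \<Longrightarrow> (\<lambda>x. \<Phi> x \<bullet> b) differentiable at x"
  shows "frechet_derivative (\<lambda>x. F (\<Phi> x)) (at x) v =
    (\<Sum>b\<in>Basis. frechet_derivative (\<lambda>x. \<Phi> x \<bullet> b) (at x) v * frechet_derivative F (at (\<Phi> x)) b)"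
proof -
  note d = differentiable_componentwise_at[OF \<Phi>]
  have "frechet_derivative (\<lambda>x. F (\<Phi> x)) (at x) v =
      frechet_derivative F (at (\<Phi> x)) (frechet_derivative \<Phi> (at x) v)"
    using frechet_derivative_compose[OF d F] by (simp add: o_def fun_eq_iff)
  also have "\<dots> = (\<Sum>b\<in>Basis. (frechet_derivative \<Phi> (at x) v \<bullet> b) *\<^sub>R frechet_derivative F (at (\<Phi> x)) b)"
    by (rule frechet_derivative_basis[OF F])
  also have "\<dots> = (\<Sum>b\<in>Basis. frechet_derivative (\<lambda>x. \<Phi> x \<bullet> b) (at x) v * frechet_derivative F (at (\<Phi> x)) b)"
    by (simp add: frechet_derivative_bounded_linear[OF bounded_linear_inner_left d])
  finally show ?thesis .
qed

section \<open>Closure properties of the classes C^k\<close>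

lemma Ck_map_const: "Ck_map k (\<lambda>_. c)"
proof (induction k arbitrary: c)
  case (Suc k)
  show ?case using Suc[of 0] by (simp add: frechet_derivative_const)
qed simp

lemma Ck_map_add: "Ck_map k f \<Longrightarrow> Ck_map k g \<Longrightarrow> Ck_map k (\<lambda>x. f x + g x)"
proof (induction k arbitrary: f g)
  case 0
  then show ?case by (simp add: continuous_on_add)
next
  case (Suc k)
  then show ?case by (simp add: frechet_derivative_add)
qed

lemma Ck_map_sum:
  assumes "finite I" "\<And>i. i \<in> I \<Longrightarrow> Ck_map k (f i)"
  shows "Ck_map k (\<lambda>x. \<Sum>i\<in>I. f i x)"
  using assms by (induction I rule: finite_induct) (auto intro: Ck_map_add Ck_map_const)

lemma Ck_map_mult:
  fixes f g :: "'a::euclidean_space \<Rightarrow> real"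
  shows "Ck_map k f \<Longrightarrow> Ck_map k g \<Longrightarrow> Ck_map k (\<lambda>x. f x * g x)"
proof (induction k arbitrary: f g)
  case 0
  then show ?case by (simp add: continuous_on_mult)
next
  case (Suc k)
  have "Ck_map k (\<lambda>x. f x * frechet_derivative g (at x) v + frechet_derivative f (at x) v * g x)" for v
    using Suc.prems by (intro Ck_map_add Suc.IH Ck_map_SucD[of k f] Ck_map_SucD[of k g]) auto
  then show ?case using Suc.prems by (simp add: frechet_derivative_mult)
qed

lemma Ck_map_bounded_linear:
  assumes l: "bounded_linear l"
  shows "Ck_map k f \<Longrightarrow> Ck_map k (\<lambda>x. l (f x))"
proof (induction k arbitrary: f)
  case 0
  then show ?case by (simp add: bounded_linear.continuous_on[OF l])
next
  case (Suc k)
  then show ?case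
    by (auto simp: frechet_derivative_bounded_linear[OF l]
        intro: differentiable_compose[OF bounded_linear_imp_differentiable[OF l]])
qed

lemma Ck_map_ident: "Ck_map k (\<lambda>x. x)"
  by (cases k) (auto simp: Ck_map_const frechet_derivative_ident)

text \<open>By the chain rule, a directional derivative of the composition is a sum of products of
  derivatives of the coordinates with partial derivatives of \<open>F\<close> composed with
  \<open>\<Phi>\<close>. The latter are compositions of the same shape, one order lower, which is
  why \<open>F\<close> is generalised in the induction.\<close>

lemma Ck_map_compose:
  fixes F :: "'b::euclidean_space \<Rightarrow> real" and \<Phi> :: "'a::euclidean_space \<Rightarrow> 'b"
  shows "Ck_map k F \<Longrightarrow> (\<And>b. b \<in> Basis \<Longrightarrow> Ck_map k (\<lambda>x. \<Phi> x \<bullet> b)) \<Longrightarrow> Ck_map k (\<lambda>x. F (\<Phi> x))"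
proof (induction k arbitrary: F)
  case 0
  have "continuous_on UNIV \<Phi>"
    using 0(2) by (subst continuous_on_componentwise) simp
  with 0(1) show ?case
    using continuous_on_compose2 by fastforce
next
  case (Suc k)
  have d: "F differentiable at y" "b \<in> Basis \<Longrightarrow> (\<lambda>x. \<Phi> x \<bullet> b) differentiable at x" for x y b
    using Suc.prems by auto
  have "(\<lambda>x. F (\<Phi> x)) differentiable at x" for x
    using differentiable_compose[OF d(1) differentiable_componentwise_at[OF d(2)]] .
  moreover have "Ck_map k (\<lambda>x. \<Sum>b\<in>Basis. frechet_derivative (\<lambda>x. \<Phi> x \<bullet> b) (at x) v *
      frechet_derivative F (at (\<Phi> x)) b)" for v
  proof (rule Ck_map_sum[OF finite_Basis])
    fix b :: 'b assume b: "b \<in> Basis"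
    have "Ck_map k (\<lambda>x. \<Phi> x \<bullet> b)" if "b \<in> Basis" for b
      using Suc.prems(2)[OF that] by (rule Ck_map_SucD)
    then have "Ck_map k (\<lambda>x. frechet_derivative F (at (\<Phi> x)) b)"
      using Suc.prems(1) by (intro Suc.IH[where F = "\<lambda>y. frechet_derivative F (at y) b"]) auto
    then show "Ck_map k (\<lambda>x. frechet_derivative (\<lambda>x. \<Phi> x \<bullet> b) (at x) v *
        frechet_derivative F (at (\<Phi> x)) b)"
      using Suc.prems(2)[OF b] by (intro Ck_map_mult) auto
  qed
  ultimately show ?case
    by (simp add: frechet_derivative_compose_basis[OF d])
qed

lemma smooth_map_differentiable: "smooth_map f \<Longrightarrow> f differentiable at x"
  unfolding smooth_map_def by (metis Ck_map.simps(2))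

lemma smooth_map_frechet_derivative:
  "smooth_map f \<Longrightarrow> smooth_map (\<lambda>x. frechet_derivative f (at x) v)"
  unfolding smooth_map_def by (metis Ck_map.simps(2))

lemma smooth_map_const: "smooth_map (\<lambda>_. c)"
  by (simp add: smooth_map_def Ck_map_const)

lemma smooth_map_add: "smooth_map f \<Longrightarrow> smooth_map g \<Longrightarrow> smooth_map (\<lambda>x. f x + g x)"
  by (simp add: smooth_map_def Ck_map_add)

lemma smooth_map_mult:
  fixes f g :: "'a::euclidean_space \<Rightarrow> real"
  shows "smooth_map f \<Longrightarrow> smooth_map g \<Longrightarrow> smooth_map (\<lambda>x. f x * g x)"
  by (simp add: smooth_map_def Ck_map_mult)

lemma smooth_map_sum:
  "finite I \<Longrightarrow> (\<And>i. i \<in> I \<Longrightarrow> smooth_map (f i)) \<Longrightarrow> smooth_map (\<lambda>x. \<Sum>i\<in>I. f i x)"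
  by (simp add: smooth_map_def Ck_map_sum)

lemma smooth_map_bounded_linear: "bounded_linear l \<Longrightarrow> smooth_map f \<Longrightarrow> smooth_map (\<lambda>x. l (f x))"
  by (simp add: smooth_map_def Ck_map_bounded_linear)

lemma smooth_map_compose:
  fixes F :: "'b::euclidean_space \<Rightarrow> real" and \<Phi> :: "'a::euclidean_space \<Rightarrow> 'b"
  shows "smooth_map F \<Longrightarrow> (\<And>b. b \<in> Basis \<Longrightarrow> smooth_map (\<lambda>x. \<Phi> x \<bullet> b)) \<Longrightarrow> smooth_map (\<lambda>x. F (\<Phi> x))"
  by (simp add: smooth_map_def Ck_map_compose)

section \<open>Rapid polynomial approximation of smooth functions\<close>

text \<open>For \<open>x\<close> in the unit interval this is the variance of the mean of
  \<open>n\<close> Bernoulli trials.\<close>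

lemma Bernstein_variance:
  assumes "n > 0"
  shows "(\<Sum>k\<le>n. (x - k / n)\<^sup>2 * Bernstein n k x) = x * (1 - x) / n"
proof -
  \<comment> \<open>The square is expanded in \<open>k (k - 1)\<close>, \<open>k\<close> and
    \<open>1\<close>, whose Bernstein sums are known in closed form.\<close>
  have "(x - k / n)\<^sup>2 * Bernstein n k x = (real k * (real k - 1) * Bernstein n k x +
      (1 - 2 * n * x) * (real k * Bernstein n k x) + (n * x)\<^sup>2 * Bernstein n k x) / n\<^sup>2" for k
    using assms by (simp add: field_simps power2_eq_square)
  then have "(\<Sum>k\<le>n. (x - k / n)\<^sup>2 * Bernstein n k x) =
      (n * (real n - 1) * x\<^sup>2 + (1 - 2 * n * x) * (n * x) + (n * x)\<^sup>2) / n\<^sup>2"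
    by (simp add: sum.distrib flip: sum_divide_distrib sum_distrib_left)
  also have "\<dots> = x * (1 - x) / n"
    using assms by (simp add: field_simps power2_eq_square)
  finally show ?thesis .
qed

text \<open>The error is a first absolute moment, which \<open>2 \<bar>d\<bar> \<le> sqrt n d\<^sup>2 + 1 / sqrt n\<close> reduces to the variance.\<close>

lemma Bernstein_Lipschitz:
  fixes g :: "real \<Rightarrow> real"
  assumes L: "\<And>x y. x \<in> {0..1} \<Longrightarrow> y \<in> {0..1} \<Longrightarrow> \<bar>g x - g y\<bar> \<le> L * \<bar>x - y\<bar>"
    and n: "n > 0" and x: "x \<in> {0..1}" and "0 \<le> L"
  shows "\<bar>g x - (\<Sum>k\<le>n. g (k / n) * Bernstein n k x)\<bar> \<le> L / sqrt n"
proof -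
  have B: "0 \<le> Bernstein n k x" for k using x by (simp add: Bernstein_nonneg)
  have abs: "2 * \<bar>d\<bar> \<le> sqrt n * d\<^sup>2 + 1 / sqrt n" for d :: real
  proof -
    have "sqrt n * d\<^sup>2 + 1 / sqrt n - 2 * \<bar>d\<bar> = (sqrt n * \<bar>d\<bar> - 1)\<^sup>2 / sqrt n"
      using n by (simp add: power2_eq_square field_simps)
    also have "\<dots> \<ge> 0" using n by simp
    finally show ?thesis by simp
  qed
  have "g x - (\<Sum>k\<le>n. g (k / n) * Bernstein n k x) = (\<Sum>k\<le>n. (g x - g (k / n)) * Bernstein n k x)"
    by (simp add: left_diff_distrib sum_subtractf flip: sum_distrib_left)
  also have "\<bar>\<dots>\<bar> \<le> (\<Sum>k\<le>n. L / 2 * (2 * \<bar>x - k / n\<bar> * Bernstein n k x))"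
  proof (rule order.trans[OF sum_abs sum_mono])
    fix k assume "k \<in> {..n}"
    then have "\<bar>g x - g (k / n)\<bar> \<le> L * \<bar>x - k / n\<bar>" using n x by (intro L) auto
    then show "\<bar>(g x - g (k / n)) * Bernstein n k x\<bar> \<le> L / 2 * (2 * \<bar>x - k / n\<bar> * Bernstein n k x)"
      using mult_right_mono[OF _ B[of k]] by (simp add: abs_mult B flip: mult.assoc)
  qed
  also have "\<dots> \<le> (\<Sum>k\<le>n. L / 2 * ((sqrt n * (x - k / n)\<^sup>2 + 1 / sqrt n) * Bernstein n k x))"
    using abs B \<open>0 \<le> L\<close> by (intro sum_mono mult_left_mono mult_right_mono) auto
  also have "\<dots> = L / 2 * (sqrt n * (\<Sum>k\<le>n. (x - k / n)\<^sup>2 * Bernstein n k x) + 1 / sqrt n)"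
  proof -
    have "(\<Sum>k\<le>n. L / 2 * ((sqrt n * (x - k / n)\<^sup>2 + 1 / sqrt n) * Bernstein n k x)) =
        L / 2 * (\<Sum>k\<le>n. sqrt n * ((x - k / n)\<^sup>2 * Bernstein n k x) + 1 / sqrt n * Bernstein n k x)"
      by (simp only: sum_distrib_left[symmetric] distrib_right mult.assoc)
    also have "\<dots> = L / 2 * (sqrt n * (\<Sum>k\<le>n. (x - k / n)\<^sup>2 * Bernstein n k x) +
        1 / sqrt n * (\<Sum>k\<le>n. Bernstein n k x))"
      by (simp only: sum.distrib sum_distrib_left)
    finally show ?thesis by simp
  qed
  also have "\<dots> = L / 2 * (sqrt n * (x * (1 - x) / n) + 1 / sqrt n)"
    by (simp only: Bernstein_variance[OF n])
  also have "\<dots> \<le> L / 2 * (sqrt n * (1 / n) + 1 / sqrt n)"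
    using x \<open>0 \<le> L\<close> mult_le_one[of x "1 - x"]
    by (intro mult_left_mono add_right_mono divide_right_mono) auto
  also have "sqrt n * (1 / n) = 1 / sqrt n" using n by (simp add: field_simps)
  finally show ?thesis by simp
qed

section \<open>Approximation rates by repeated integration\<close>

lemma poly_antiderivative:
  fixes q :: "real poly"
  assumes "degree q \<le> n"
  obtains Q where "pderiv Q = q" "degree Q \<le> Suc n"
proof
  define Q where "Q = (\<Sum>i\<le>n. monom (coeff q i / Suc i) (Suc i))"
  show "pderiv Q = q"
    using poly_as_sum_of_monoms'[OF assms]
    by (simp add: Q_def higher_pderiv_sum[where n = 1, simplified] pderiv_monom del: of_nat_Suc)
  show "degree Q \<le> Suc n"
    unfolding Q_def by (intro degree_sum_le) (auto intro: order.trans[OF degree_monom_le])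
qed

text \<open>Integrate, then correct: if \<open>Q\<close> is an antiderivative of \<open>q\<close>,
  then \<open>g - Q\<close> has Lipschitz constant \<open>e\<close> on the unit interval, so its
  Bernstein polynomial of degree at most \<open>Suc n\<close> errs by at most
  \<open>e / sqrt (Suc n)\<close>. Each derivative of \<open>g\<close> thus gains one such
  root.\<close>

lemma approx_step:
  fixes g g' :: "real \<Rightarrow> real"
  assumes g: "\<And>x. (g has_real_derivative g' x) (at x)" and q: "degree q \<le> n"
    and e: "\<And>x. x \<in> {0..1} \<Longrightarrow> \<bar>g' x - poly q x\<bar> \<le> e"
  shows "\<exists>p. degree p \<le> Suc n \<and> (\<forall>x\<in>{0..1}. \<bar>g x - poly p x\<bar> \<le> e / sqrt (Suc n))"
proof -
  obtain Q where Q: "pderiv Q = q" "degree Q \<le> Suc n" using q by (rule poly_antiderivative)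
  define h where "h x = g x - poly Q x" for x
  \<comment> \<open>The Bernstein polynomial of \<open>h\<close>, as an element of the polynomial
    type so that its degree can be bounded.\<close>
  define p where "p = (\<Sum>k\<le>Suc n. smult (h (k / Suc n) * (Suc n choose k)) (monom 1 k * [:1, -1:] ^ (Suc n - k)))"
  have "degree (monom 1 k * [:1, -1::real:] ^ (Suc n - k)) \<le> Suc n" if "k \<le> Suc n" for k
    using that degree_mult_le[of "monom 1 k" "[:1, -1::real:] ^ (Suc n - k)"]
      degree_power_le[of "[:1, -1::real:]" "Suc n - k"] degree_monom_le[of "1::real" k] by simp
  then have degp: "degree p \<le> Suc n"
    unfolding p_def by (intro degree_sum_le) (auto intro: order.trans[OF degree_smult_le])
  have p: "poly p x = (\<Sum>k\<le>Suc n. h (k / Suc n) * Bernstein (Suc n) k x)" for x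
    unfolding p_def poly_sum Bernstein_def
    by (intro sum.cong) (auto simp: poly_monom simp del: of_nat_Suc binomial_Suc_Suc)
  have "(h has_real_derivative g' x - poly q x) (at x within {0..1})" for x
    unfolding h_def Q(1)[symmetric]
    by (intro DERIV_diff has_field_derivative_at_within[OF g]
        has_field_derivative_at_within[OF poly_DERIV])
  then have h: "\<bar>h x - h y\<bar> \<le> e * \<bar>x - y\<bar>" if "x \<in> {0..1}" "y \<in> {0..1}" for x y
    using field_differentiable_bound[of "{0..1}" h "\<lambda>x. g' x - poly q x" e x y] e that by auto
  have "0 \<le> e" using e[of 0] by simp
  have "\<bar>g x - poly (p + Q) x\<bar> \<le> e / sqrt (Suc n)" if "x \<in> {0..1}" for x
    using Bernstein_Lipschitz[OF h _ that \<open>0 \<le> e\<close>, of "Suc n"]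
    by (simp add: p h_def algebra_simps del: of_nat_Suc sum.atMost_Suc)
  then show ?thesis using degp Q(2) by (intro exI[of _ "p + Q"]) (auto intro: degree_add_le)
qed

lemma Ck_map_real_derivative:
  fixes g :: "real \<Rightarrow> real"
  assumes "Ck_map (Suc k) g"
  shows "(g has_real_derivative frechet_derivative g (at x) 1) (at x)"
proof -
  have g: "(g has_derivative frechet_derivative g (at x)) (at x)"
    using assms by (simp flip: frechet_derivative_works)
  then interpret bounded_linear "frechet_derivative g (at x)" by (rule has_derivative_bounded_linear)
  have "frechet_derivative g (at x) = (*) (frechet_derivative g (at x) 1)"
    by (rule ext) (metis scaleR mult.commute mult.right_neutral real_scaleR_def)
  with g show ?thesis by (simp add: has_field_derivative_def)
qed

text \<open>Induction on \<open>k\<close>: approximate the derivative, then apply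
  \<open>approx_step\<close>, which raises the degree by one and gains a square root.\<close>

lemma Ck_map_approx_unit_interval:
  fixes g :: "real \<Rightarrow> real"
  assumes "Ck_map k g"
  shows "\<exists>C\<ge>0. \<forall>n. \<exists>p. degree p \<le> n \<and>
    (\<forall>x\<in>{0..1}. \<bar>g x - poly p x\<bar> \<le> C / sqrt (Suc n) ^ k)"
  using assms
proof (induction k arbitrary: g)
  have bounded: "\<exists>B\<ge>0. \<forall>x\<in>{0..1}. \<bar>g x\<bar> \<le> B" if "continuous_on UNIV g" for g :: "real \<Rightarrow> real"
  proof -
    have "bounded (g ` {0..1})"
      using that by (intro compact_imp_bounded compact_continuous_image) (auto intro: continuous_on_subset)
    then obtain B where "\<And>x. x \<in> {0..1} \<Longrightarrow> \<bar>g x\<bar> \<le> B"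
      by (metis bounded_iff image_eqI real_norm_def)
    then show ?thesis by (intro exI[of _ "\<bar>B\<bar>"]) force
  qed
  \<comment> \<open>Absorbs the shift between \<open>Suc m\<close> and \<open>Suc n\<close> into a
    constant.\<close>
  have le_ratio: "C / a \<le> K * C / b" if "b \<le> K * a" "0 < a" "0 < b" "0 \<le> C" for C a b K :: real
    using mult_left_mono[OF that(1,4)] that(2,3) by (simp add: field_simps)
  {
    case 0
    then obtain B where "B \<ge> 0" "\<forall>x\<in>{0..1}. \<bar>g x\<bar> \<le> B" using bounded[of g] by auto
    then show ?case by (intro exI[of _ B]) (auto intro!: exI[of _ 0])
  next
    case (Suc k)
    let ?g' = "\<lambda>x. frechet_derivative g (at x) 1"
    obtain C where C: "C \<ge> 0" "\<And>n. \<exists>q. degree q \<le> n \<and>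
        (\<forall>x\<in>{0..1}. \<bar>?g' x - poly q x\<bar> \<le> C / sqrt (Suc n) ^ k)"
      using Suc.IH[of ?g'] Suc.prems by auto
    obtain B where B: "B \<ge> 0" "\<And>x. x \<in> {0..1} \<Longrightarrow> \<bar>g x\<bar> \<le> B"
      using bounded[of g] Ck_map_SucD[OF Suc.prems] Suc.prems
      by (auto simp: continuous_on_eq_continuous_at differentiable_imp_continuous_within)
    \<comment> \<open>\<open>B\<close> covers degree 0, where the zero polynomial is used; the other
      summand covers \<open>n = Suc m\<close>, its power of 2 coming from
      \<open>sqrt (Suc n) \<le> 2 * sqrt (Suc m)\<close>.\<close>
    define D where "D = B + 2 ^ Suc k * C"
    have D: "D \<ge> 0" using B C by (simp add: D_def)
    have "\<exists>p. degree p \<le> n \<and> (\<forall>x\<in>{0..1}. \<bar>g x - poly p x\<bar> \<le> D / sqrt (Suc n) ^ Suc k)" for n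
    proof (cases n)
      case 0
      then show ?thesis using B C by (intro exI[of _ 0]) (auto simp: D_def intro: add_increasing2)
    next
      case (Suc m)
      obtain q where q: "degree q \<le> m" "\<And>x. x \<in> {0..1} \<Longrightarrow> \<bar>?g' x - poly q x\<bar> \<le> C / sqrt (Suc m) ^ k"
        using C(2)[of m] by blast
      obtain p where p: "degree p \<le> Suc m"
        "\<And>x. x \<in> {0..1} \<Longrightarrow> \<bar>g x - poly p x\<bar> \<le> C / sqrt (Suc m) ^ k / sqrt (Suc m)"
        using approx_step[OF Ck_map_real_derivative[OF Suc.prems] q] by auto
      have "sqrt (Suc n) \<le> 2 * sqrt (Suc m)"
        using Suc by (intro real_le_lsqrt) (auto simp: power_mult_distrib)
      then have "sqrt (Suc n) ^ Suc k \<le> 2 ^ Suc k * sqrt (Suc m) ^ Suc k"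
        unfolding power_mult_distrib[symmetric] by (intro power_mono) auto
      moreover have "0 < sqrt (Suc m)" "0 < sqrt (Suc n)" by simp_all
      ultimately have "C / sqrt (Suc m) ^ Suc k \<le> 2 ^ Suc k * C / sqrt (Suc n) ^ Suc k"
        by (intro le_ratio[OF _ _ _ C(1)]) auto
      also have "\<dots> \<le> D / sqrt (Suc n) ^ Suc k"
        using B by (intro divide_right_mono) (auto simp: D_def)
      finally have "C / sqrt (Suc m) ^ k / sqrt (Suc m) \<le> D / sqrt (Suc n) ^ Suc k"
        by (simp only: divide_divide_eq_left power_Suc2)
      from order.trans[OF p(2) this] p(1) show ?thesis
        unfolding Suc by (intro exI[of _ p]) blast
    qed
    with D show ?case by blast
  }
qed

text \<open>Each derivative gains only a square root, so the rate \<open>k\<close> takes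
  \<open>2 * k\<close> derivatives. An affine substitution carries \<open>[-R, R]\<close> to the
  unit interval.\<close>

lemma smooth_map_rapid_approx:
  fixes g :: "real \<Rightarrow> real"
  assumes g: "smooth_map g" and R: "R > 0"
  shows "\<exists>C\<ge>0. \<forall>n. \<exists>p. degree p \<le> n \<and> (\<forall>x. \<bar>x\<bar> \<le> R \<longrightarrow> \<bar>g x - poly p x\<bar> \<le> C / real (Suc n) ^ k)"
proof -
  have "Ck_map (2 * k) (\<lambda>t. 2 * R * t + - R)"
    by (rule Ck_map_add[OF Ck_map_mult[OF Ck_map_const Ck_map_ident] Ck_map_const])
  moreover have "Ck_map (2 * k) g" using g by (simp add: smooth_map_def)
  ultimately have "Ck_map (2 * k) (\<lambda>t. g (2 * R * t - R))"
    using Ck_map_compose[of "2 * k" g "\<lambda>t. 2 * R * t - R"] by simp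
  from Ck_map_approx_unit_interval[OF this]
  obtain C where C: "C \<ge> 0" "\<And>n. \<exists>p. degree p \<le> n \<and>
      (\<forall>t\<in>{0..1}. \<bar>g (2 * R * t - R) - poly p t\<bar> \<le> C / sqrt (Suc n) ^ (2 * k))" by blast
  have "\<exists>p. degree p \<le> n \<and> (\<forall>x. \<bar>x\<bar> \<le> R \<longrightarrow> \<bar>g x - poly p x\<bar> \<le> C / real (Suc n) ^ k)" for n
  proof -
    obtain p where p: "degree p \<le> n"
      "\<And>t. t \<in> {0..1} \<Longrightarrow> \<bar>g (2 * R * t - R) - poly p t\<bar> \<le> C / sqrt (Suc n) ^ (2 * k)"
      using C(2) by blast
    define q where "q = pcompose p [:1 / 2, 1 / (2 * R):]"
    have "degree q \<le> n" using p(1) R by (simp add: q_def degree_pcompose)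
    moreover have "\<bar>g x - poly q x\<bar> \<le> C / real (Suc n) ^ k" if "\<bar>x\<bar> \<le> R" for x
    proof -
      have "(x + R) / (2 * R) \<in> {0..1}"
        using that R by (simp add: abs_le_iff)
      moreover have "2 * R * ((x + R) / (2 * R)) - R = x"
        using R by simp
      moreover have "poly q x = poly p ((x + R) / (2 * R))"
        using R by (simp add: q_def poly_pcompose add_divide_distrib add.commute)
      ultimately show ?thesis using p(2)[of "(x + R) / (2 * R)"] by (simp add: power_mult)
    qed
    ultimately show ?thesis by blast
  qed
  with C(1) show ?thesis by blast
qed

section \<open>Polynomial functions and termwise differentiation\<close>

lemma higher_deriv_poly: "(deriv ^^ k) (poly Q) = poly ((pderiv ^^ k) Q)" for Q :: "complex poly"
proof (induction k)
  case (Suc k)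
  have "deriv (poly P) = poly (pderiv P)" for P :: "complex poly"
    by (rule ext, rule DERIV_imp_deriv) simp
  with Suc show ?case by simp
qed simp

text \<open>Cauchy's inequality for the \<open>j\<close>-th derivative at 0 on the unit circle; the
  factorials cancel.\<close>

lemma norm_coeff_le_circle:
  fixes Q :: "complex poly"
  assumes "\<And>z. norm z = 1 \<Longrightarrow> norm (poly Q z) \<le> M"
  shows "norm (coeff Q j) \<le> M"
proof -
  have "norm ((deriv ^^ j) (poly Q) 0) \<le> fact j * M / 1 ^ j"
    by (rule Cauchy_inequality) (auto intro!: holomorphic_intros continuous_intros assms)
  also have "(deriv ^^ j) (poly Q) 0 = fact j * coeff Q j"
    by (simp add: higher_deriv_poly poly_0_coeff_0 coeff_higher_pderiv pochhammer_fact)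
  finally show ?thesis by (simp add: norm_mult)
qed

lemma coeff_1_le_interval:
  fixes p :: "real poly"
  assumes deg: "degree p \<le> n" and M: "\<And>t. \<bar>t\<bar> \<le> 1 \<Longrightarrow> \<bar>poly p t\<bar> \<le> M"
  shows "\<bar>coeff p 1\<bar> \<le> (2 * real n + 1)\<^sup>2 * M"
proof (cases "n = 0")
  case True
  then show ?thesis using deg M[of 0] by (simp add: coeff_eq_0)
next
  case False
  (* On the unit circle z^2 - 1 = 2 i z Im z, so Q z = z^n p (Im z) there and the coefficients of Q are
     bounded by M, while the derivative of Q at 1 encodes that of p at 0. *)
  define U :: "complex poly" where "U = [:\<i>/2, 0, -\<i>/2:]"
  define Q where "Q = (\<Sum>k\<le>n. smult (of_real (coeff p k)) (U ^ k * monom 1 (n - k)))"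
  have p: "poly p t = (\<Sum>k\<le>n. coeff p k * t ^ k)" for t
    by (subst poly_as_sum_of_monoms'[OF deg, symmetric]) (simp add: poly_sum poly_monom)
  have M0: "0 \<le> M" using M[of 0] by linarith
  have "norm (poly Q z) \<le> M" if z: "norm z = 1" for z
  proof -
    have "z * cnj z = 1" using z by (simp add: complex_norm_square[symmetric])
    moreover have "z - cnj z = 2 * \<i> * of_real (Im z)" by (simp add: complex_eq_iff)
    ultimately have "z * z - 1 = z * (2 * \<i> * of_real (Im z))"
      by (metis right_diff_distrib)
    then have U: "poly U z = z * of_real (Im z)"
      by (simp add: U_def field_simps)
    have "poly Q z = (\<Sum>k\<le>n. z ^ n * of_real (coeff p k * Im z ^ k))"
      unfolding Q_def poly_sum
    proof (rule sum.cong[OF refl])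
      fix k assume "k \<in> {..n}"
      then have "z ^ n = z ^ k * z ^ (n - k)" by (simp flip: power_add)
      then show "poly (smult (of_real (coeff p k)) (U ^ k * monom 1 (n - k))) z =
          z ^ n * of_real (coeff p k * Im z ^ k)"
        by (simp add: U poly_monom power_mult_distrib)
    qed
    also have "\<dots> = z ^ n * of_real (poly p (Im z))"
      by (simp add: p sum_distrib_left)
    finally show ?thesis
      using M[of "Im z"] abs_Im_le_cmod[of z] z by (simp add: norm_mult norm_power)
  qed
  then have cQ: "norm (coeff Q j) \<le> M" for j by (rule norm_coeff_le_circle)
  have "degree (U ^ k * monom 1 (n - k)) \<le> 2 * n" if "k \<le> n" for k
  proof -
    have "degree (U ^ k * monom 1 (n - k)) \<le> degree U * k + (n - k)"
      by (rule order.trans[OF degree_mult_le add_mono[OF degree_power_le degree_monom_le]])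
    also have "degree U = 2" by (simp add: U_def)
    finally show ?thesis using that by simp
  qed
  then have degQ: "degree Q \<le> 2 * n"
    unfolding Q_def by (intro degree_sum_le) (auto intro: order.trans[OF degree_smult_le])
  \<comment> \<open>\<open>U\<close> vanishes at 1 and has derivative \<open>-\<i>\<close> there, so
    in the end only the terms \<open>k = 0\<close> and \<open>k = 1\<close> contribute.\<close>
  have "poly (pderiv Q) 1 = (\<Sum>k\<le>n. of_real (coeff p k) *
      (of_nat (n - k) * 0 ^ k + of_nat k * 0 ^ (k - 1) * (-\<i>)))"
    by (simp add: Q_def U_def higher_pderiv_sum[where n = 1, simplified] pderiv_smult pderiv_mult pderiv_power pderiv_monom
        poly_sum poly_monom pderiv_pCons algebra_simps)
  also have "\<dots> = (\<Sum>k\<in>{0,1}. of_real (coeff p k) *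
      (of_nat (n - k) * 0 ^ k + of_nat k * 0 ^ (k - 1) * (-\<i>)))"
    using False by (intro sum.mono_neutral_right) (auto simp: power_0_left)
  also have "\<dots> = of_real (coeff p 0) * of_nat n - of_real (coeff p 1) * \<i>"
    by simp
  finally have "of_real (coeff p 1) * \<i> = of_real (coeff p 0) * of_nat n - poly (pderiv Q) 1"
    by simp
  then have "\<bar>coeff p 1\<bar> = norm (of_real (coeff p 0) * of_nat n - poly (pderiv Q) 1)"
    by (metis norm_ii norm_mult norm_of_real mult.right_neutral)
  also have "\<dots> \<le> norm (of_real (coeff p 0) * of_nat n :: complex) + norm (poly (pderiv Q) 1)"
    by (rule norm_triangle_ineq4)
  also have "norm (of_real (coeff p 0) * of_nat n :: complex) \<le> M * n"
    using M[of 0] by (simp add: norm_mult poly_0_coeff_0 mult_right_mono)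
  also have "norm (poly (pderiv Q) 1) \<le> 4 * (real n)\<^sup>2 * M"
  proof -
    have "degree (pderiv Q) \<le> 2 * n - 1"
      using degQ by (simp add: degree_pderiv)
    from poly_as_sum_of_monoms'[OF this] have "poly (pderiv Q) 1 = poly (\<Sum>j\<le>2 * n - 1. monom (coeff (pderiv Q) j) j) 1"
      by simp
    also have "\<dots> = (\<Sum>j\<le>2 * n - 1. of_nat (Suc j) * coeff Q (Suc j))"
      by (simp add: poly_sum poly_monom coeff_pderiv)
    also have "norm \<dots> \<le> (\<Sum>j\<le>2 * n - 1. real (2 * n) * M)"
    proof (rule sum_norm_le)
      fix j assume "j \<in> {..2 * n - 1}"
      then have "real (Suc j) \<le> real (2 * n)" using False by auto
      then have "real (Suc j) * norm (coeff Q (Suc j)) \<le> real (2 * n) * M"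
        using cQ by (intro mult_mono) auto
      then show "norm (of_nat (Suc j) * coeff Q (Suc j)) \<le> real (2 * n) * M"
        by (simp only: norm_mult norm_of_nat)
    qed
    \<comment> \<open>Since \<open>n > 0\<close>, the index range has exactly \<open>2 * n\<close>
      elements.\<close>
    also have "\<dots> = 4 * (real n)\<^sup>2 * M"
      using False by (simp add: power2_eq_square of_nat_diff)
    finally show ?thesis .
  qed
  also have "M * real n + 4 * (real n)\<^sup>2 * M \<le> (2 * real n + 1)\<^sup>2 * M"
    using M0 by (simp add: power2_eq_square algebra_simps)
  finally show ?thesis by simp
qed

section \<open>Polynomial functions on a Euclidean space\<close>

text \<open>The index bounds the total degree. With linear forms as generators instead of monomials,
  differentiation and restriction to lines go by rule induction, and the entries of matrix powers
  fit the rules directly.\<close>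

inductive poly_fun :: "nat \<Rightarrow> ('a::euclidean_space \<Rightarrow> real) \<Rightarrow> bool" where
  const: "poly_fun n (\<lambda>_. c)"
| times: "bounded_linear l \<Longrightarrow> poly_fun n f \<Longrightarrow> poly_fun (Suc n) (\<lambda>x. l x * f x)"
| plus: "poly_fun n f \<Longrightarrow> poly_fun n g \<Longrightarrow> poly_fun n (\<lambda>x. f x + g x)"

lemma poly_fun_Suc: "poly_fun n f \<Longrightarrow> poly_fun (Suc n) f"
  by (induction rule: poly_fun.induct) (auto intro: poly_fun.intros)

lemma poly_fun_mono:
  assumes "poly_fun m f" "m \<le> n"
  shows "poly_fun n f"
  using assms(2,1) by (induction n rule: dec_induct) (auto intro: poly_fun_Suc)

lemma poly_fun_scale: "poly_fun n f \<Longrightarrow> poly_fun n (\<lambda>x. c * f x)"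
proof (induction rule: poly_fun.induct)
  case (times l n f)
  then show ?case using poly_fun.times[of l n "\<lambda>x. c * f x"] by (simp add: mult.left_commute)
next
  case (plus n f g)
  then show ?case using poly_fun.plus[OF plus.IH] by (simp add: distrib_left)
qed (rule poly_fun.const)

lemma poly_fun_diff: "poly_fun n f \<Longrightarrow> poly_fun n g \<Longrightarrow> poly_fun n (\<lambda>x. f x - g x)"
  using poly_fun.plus[of n f "\<lambda>x. -1 * g x"] poly_fun_scale[of n g "-1"] by simp

lemma poly_fun_sum:
  assumes "finite I" "\<And>i. i \<in> I \<Longrightarrow> poly_fun n (f i)"
  shows "poly_fun n (\<lambda>x. \<Sum>i\<in>I. f i x)"
  using assms by (induction I rule: finite_induct) (auto intro: poly_fun.intros)

lemma poly_fun_differentiable: "poly_fun n f \<Longrightarrow> f differentiable at x"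
  by (induction rule: poly_fun.induct)
    (auto intro!: differentiable_mult intro: bounded_linear_imp_differentiable)

text \<open>The product rule replaces the linear form \<open>l\<close> by the constant
  \<open>l v\<close>. Keeping the bound \<open>n\<close> lets the same Markov factor serve for all
  iterated derivatives.\<close>

lemma poly_fun_frechet_derivative:
  "poly_fun n f \<Longrightarrow> poly_fun n (\<lambda>x. frechet_derivative f (at x) v)"
proof (induction rule: poly_fun.induct)
  case (const n c)
  then show ?case by (simp add: poly_fun.const)
next
  case (times l n f)
  have "frechet_derivative l (at x) v = l v" for x
    using frechet_derivative_at[OF bounded_linear_imp_has_derivative[OF times(1)]] by metis
  then have "frechet_derivative (\<lambda>x. l x * f x) (at x) v =
      l x * frechet_derivative f (at x) v + l v * f x" for x
    using times by (subst frechet_derivative_mult)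
      (auto intro: poly_fun_differentiable bounded_linear_imp_differentiable)
  then show ?case
    using times by (simp add: poly_fun.intros poly_fun_Suc poly_fun_scale)
next
  case (plus n f g)
  then show ?case
    by (simp add: frechet_derivative_add poly_fun_differentiable poly_fun.plus)
qed

text \<open>On a line, a linear form is \<open>l x + t * l v\<close>, of degree at most 1 in
  \<open>t\<close>. This reduces derivative bounds to one variable.\<close>

lemma poly_fun_line:
  assumes "poly_fun n f"
  obtains q where "degree q \<le> n" "\<And>t. f (x + t *\<^sub>R v) = poly q t"
proof -
  from assms have "\<exists>q. degree q \<le> n \<and> (\<forall>t. f (x + t *\<^sub>R v) = poly q t)"
  proof (induction rule: poly_fun.induct)
    case (const n c)
    show ?case by (rule exI[of _ "[:c:]"]) simp
  next
    case (times l n f)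
    then obtain q where q: "degree q \<le> n" "\<And>t. f (x + t *\<^sub>R v) = poly q t" by blast
    interpret bounded_linear l by fact
    have "degree ([:l x, l v:] * q) \<le> Suc n"
      by (rule order.trans[OF degree_mult_le]) (use q in auto)
    moreover have "l (x + t *\<^sub>R v) * f (x + t *\<^sub>R v) = poly ([:l x, l v:] * q) t" for t
      by (simp add: q add scaleR algebra_simps)
    ultimately show ?case by blast
  next
    case (plus n f g)
    then obtain p q where "degree p \<le> n" "\<And>t. f (x + t *\<^sub>R v) = poly p t"
      "degree q \<le> n" "\<And>t. g (x + t *\<^sub>R v) = poly q t" by blast
    then show ?case by (intro exI[of _ "p + q"]) (auto intro: degree_add_le)
  qed
  with that show thesis by blast
qed

text \<open>In a unit direction the derivative is the linear coefficient of \<open>f\<close> along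
  the line through \<open>x\<close>, so \<open>coeff_1_le_interval\<close> applies. Its parameter
  range moves \<open>x\<close> by at most 1, whence the radius \<open>R + 1\<close>.\<close>

lemma poly_fun_frechet_derivative_le:
  assumes f: "poly_fun n f" and M: "\<And>y. norm y < R + 1 \<Longrightarrow> \<bar>f y\<bar> \<le> M" and x: "norm x < R"
  shows "\<bar>frechet_derivative f (at x) v\<bar> \<le> (2 * real n + 1)\<^sup>2 * M * norm v"
proof (cases "v = 0")
  case True
  then show ?thesis
    using linear_0[OF linear_frechet_derivative[OF poly_fun_differentiable[OF f]]] by simp
next
  case False
  define w where "w = v /\<^sub>R norm v"
  have w: "norm w = 1" "v = norm v *\<^sub>R w" using False by (auto simp: w_def)
  obtain q where q: "degree q \<le> n" "\<And>t. f (x + t *\<^sub>R w) = poly q t"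
    using f by (rule poly_fun_line[of _ _ x w]) blast
  have "((\<lambda>t. f (x + t *\<^sub>R w)) has_derivative (\<lambda>t. frechet_derivative f (at x) (t *\<^sub>R w))) (at 0)"
    by (rule has_derivative_compose[of "\<lambda>t. x + t *\<^sub>R w"])
      (use poly_fun_differentiable[OF f, of x] in
        \<open>auto intro!: derivative_eq_intros simp: frechet_derivative_works\<close>)
  then have "(poly q has_derivative (\<lambda>t. frechet_derivative f (at x) (t *\<^sub>R w))) (at 0)"
    by (simp add: q)
  moreover have "(poly q has_derivative (\<lambda>t. coeff q 1 * t)) (at 0)"
    using poly_DERIV[of q 0]
    by (simp add: has_field_derivative_def poly_0_coeff_0 coeff_pderiv)
  ultimately have "frechet_derivative f (at x) (1 *\<^sub>R w) = coeff q 1 * 1"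
    by (metis has_derivative_unique)
  moreover have "\<bar>coeff q 1\<bar> \<le> (2 * real n + 1)\<^sup>2 * M"
  proof (rule coeff_1_le_interval[OF q(1)])
    fix t :: real assume "\<bar>t\<bar> \<le> 1"
    then have "norm (x + t *\<^sub>R w) < R + 1"
      using norm_triangle_ineq[of x "t *\<^sub>R w"] x w by simp
    then show "\<bar>poly q t\<bar> \<le> M" using M q by metis
  qed
  moreover have "frechet_derivative f (at x) v = norm v * frechet_derivative f (at x) w"
    by (subst w(2), subst linear_cmul[OF linear_frechet_derivative[OF poly_fun_differentiable[OF f]]])
      simp
  ultimately show ?thesis by (simp add: abs_mult mult.commute mult_left_mono)
qed

section \<open>Iterated directional derivatives and termwise differentiation of series\<close>

primrec iter_deriv :: "'a list \<Rightarrow> ('a::euclidean_space \<Rightarrow> real) \<Rightarrow> 'a \<Rightarrow> real" where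
  "iter_deriv [] f = f"
| "iter_deriv (v # vs) f = iter_deriv vs (\<lambda>x. frechet_derivative f (at x) v)"

text \<open>Each derivative costs a factor \<open>(2 * real n + 1)\<^sup>2\<close>, the norm of its
  direction and one unit of radius.\<close>

lemma poly_fun_iter_deriv_le:
  fixes R M :: real
  assumes "poly_fun n f" "\<And>y. norm y < R + length vs \<Longrightarrow> \<bar>f y\<bar> \<le> M" "norm x < R"
  shows "\<bar>iter_deriv vs f x\<bar> \<le> (2 * real n + 1) ^ (2 * length vs) * M * prod_list (map norm vs)"
  using assms
proof (induction vs arbitrary: f M)
  case (Cons v vs)
  have "\<bar>iter_deriv vs (\<lambda>x. frechet_derivative f (at x) v) x\<bar> \<le>
      (2 * real n + 1) ^ (2 * length vs) * ((2 * real n + 1)\<^sup>2 * M * norm v) * prod_list (map norm vs)"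
    using Cons.prems(1,3)
    by (intro Cons.IH poly_fun_frechet_derivative poly_fun_frechet_derivative_le[OF Cons.prems(1)])
      (auto intro!: Cons.prems(2) simp: algebra_simps)
  then show ?case by (simp add: algebra_simps power_add power2_eq_square)
qed simp

text \<open>A local form of \<open>Ck_map\<close>, because the series below are controlled only on
  bounded sets. Derivatives are taken \<open>at x\<close>, not within \<open>S\<close>, so the
  notion is meant for open sets.\<close>

primrec Ck_on :: "nat \<Rightarrow> 'a set \<Rightarrow> ('a::euclidean_space \<Rightarrow> real) \<Rightarrow> bool" where
  "Ck_on 0 S f \<longleftrightarrow> continuous_on S f"
| "Ck_on (Suc k) S f \<longleftrightarrow>
     (\<forall>x\<in>S. f differentiable at x) \<and> (\<forall>v. Ck_on k S (\<lambda>x. frechet_derivative f (at x) v))"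

lemma Ck_on_cong:
  assumes "open S" "\<And>x. x \<in> S \<Longrightarrow> f x = g x"
  shows "Ck_on k S f \<Longrightarrow> Ck_on k S g"
  using assms(2)
proof (induction k arbitrary: f g)
  case 0
  then show ?case using continuous_on_cong by auto
next
  case (Suc k)
  have hd: "(f has_derivative D) (at x) \<Longrightarrow> (g has_derivative D) (at x)" if "x \<in> S" for x D
    using has_derivative_transform_within_open[OF _ \<open>open S\<close> that] Suc.prems(2) by blast
  have "g differentiable at x" "frechet_derivative f (at x) v = frechet_derivative g (at x) v"
    if "x \<in> S" for x v
  proof -
    have "(g has_derivative frechet_derivative f (at x)) (at x)"
      using Suc.prems(1) that by (intro hd) (auto simp: frechet_derivative_works)
    then show "g differentiable at x" "frechet_derivative f (at x) v = frechet_derivative g (at x) v"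
      by (auto simp: differentiable_def dest: frechet_derivative_at)
  qed
  with Suc.prems(1) show ?case
    by (auto intro: Suc.IH)
qed

text \<open>Every \<open>x\<close> lies in the open ball of radius \<open>norm x + 1\<close>, and
  continuity and differentiability are local.\<close>

lemma Ck_map_if_Ck_on_balls:
  "(\<And>R. 0 < R \<Longrightarrow> Ck_on k (ball 0 R) f) \<Longrightarrow> Ck_map k f"
proof (induction k arbitrary: f)
  case 0
  have "continuous (at x) f" for x
    using 0[of "norm x + 1"]
    by (simp add: continuous_on_eq_continuous_at)
      (metis add_nonneg_pos less_add_one mem_ball_0 norm_ge_zero zero_less_one)
  then show ?case by (simp add: continuous_on_eq_continuous_at)
next
  case (Suc k)
  have "f differentiable at x" for x
    using Suc.prems[of "norm x + 1"] norm_ge_zero[of x] by (simp add: add_nonneg_pos)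
  moreover have "Ck_map k (\<lambda>x. frechet_derivative f (at x) v)" for v
    using Suc.prems by (intro Suc.IH) auto
  ultimately show ?case by simp
qed

text \<open>The Weierstrass test gives continuity. For one more order, the series of derivatives
  converges uniformly in operator norm, so its sum is the derivative of \<open>F\<close>. Its terms
  are again polynomial, with summable bounds for shorter lists of directions, so the induction
  hypothesis applies to it.\<close>

lemma Ck_on_series:
  fixes G :: "nat \<Rightarrow> 'a::euclidean_space \<Rightarrow> real"
  assumes S: "open S" "convex S"
    and G: "\<And>n. \<exists>d. poly_fun d (G n)"
    and M: "\<And>vs. length vs \<le> k \<Longrightarrow>
      \<exists>M. summable M \<and> (\<forall>n. \<forall>x\<in>S. \<bar>iter_deriv vs (G n) x\<bar> \<le> M n)"
    and F: "\<And>x. x \<in> S \<Longrightarrow> (\<lambda>n. G n x) sums F x"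
  shows "Ck_on k S F"
  using G M F
proof (induction k arbitrary: G F)
  case 0
  obtain M where M: "summable M" "\<And>n x. x \<in> S \<Longrightarrow> \<bar>G n x\<bar> \<le> M n"
    using 0(2)[of "[]"] by auto
  have "uniform_limit S (\<lambda>n x. \<Sum>i<n. G i x) (\<lambda>x. \<Sum>i. G i x) sequentially"
    using M by (intro Weierstrass_m_test) auto
  moreover have "continuous_on S (\<lambda>x. \<Sum>i<n. G i x)" for n
    using 0(1) by (intro continuous_on_sum)
      (meson poly_fun_differentiable continuous_at_imp_continuous_on differentiable_imp_continuous_within)
  ultimately have "continuous_on S (\<lambda>x. \<Sum>i. G i x)"
    by (intro uniform_limit_theorem) (auto intro: always_eventually)
  then show ?case
    by (subst Ck_on.simps, subst continuous_on_cong[of _ S _ "\<lambda>x. \<Sum>i. G i x"])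
      (use 0(3) in \<open>auto simp: sums_iff\<close>)
next
  case (Suc k)
  have dG: "G n differentiable at x" for n x
    using Suc.prems(1) poly_fun_differentiable by blast
  have "\<exists>M. summable M \<and> (\<forall>n. \<forall>x\<in>S. \<bar>frechet_derivative (G n) (at x) v\<bar> \<le> M n)" for v
    using Suc.prems(2)[of "[v]"] by simp
  then obtain M where M: "\<And>v. summable (M v)"
    "\<And>v n x. x \<in> S \<Longrightarrow> \<bar>frechet_derivative (G n) (at x) v\<bar> \<le> M v n" by metis
  \<comment> \<open>Summing the bounds over the basis gives one that is linear in
    \<open>norm v\<close>, as uniform convergence of the derivatives as linear maps
    requires.\<close>
  define N where "N n = (\<Sum>b\<in>Basis. M b n)" for n
  have N: "summable N" unfolding N_def using M(1) by (rule summable_sum)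
  have le: "\<bar>frechet_derivative (G n) (at x) v\<bar> \<le> N n * norm v" if "x \<in> S" for n x v
  proof -
    have "\<bar>frechet_derivative (G n) (at x) v\<bar> \<le> (\<Sum>b\<in>Basis. \<bar>(v \<bullet> b) * frechet_derivative (G n) (at x) b\<bar>)"
      by (subst frechet_derivative_basis[OF dG]) (simp add: sum_abs)
    also have "\<dots> \<le> (\<Sum>b\<in>Basis. norm v * M b n)"
      using M(2)[OF that] by (intro sum_mono) (auto simp: abs_mult intro!: mult_mono Basis_le_norm)
    finally show ?thesis by (simp add: N_def sum_distrib_left mult.commute)
  qed
  define D where "D x v = (\<Sum>n. frechet_derivative (G n) (at x) v)" for x v
  have sumD: "(\<lambda>n. frechet_derivative (G n) (at x) v) sums D x v" if "x \<in> S" for x v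
    unfolding D_def
    by (intro summable_sums summable_comparison_test'[OF M(1)[of v], of 0]) (simp add: M(2) that)
  have unif: "\<forall>\<^sub>F n in sequentially. \<forall>x\<in>S. \<forall>h.
      norm ((\<Sum>i<n. frechet_derivative (G i) (at x) h) - D x h) \<le> e * norm h" if e: "0 < e" for e
  proof -
    obtain n0 where n0: "\<And>n. n0 \<le> n \<Longrightarrow> (\<Sum>i. N (i + n)) < e"
      using suminf_exist_split[OF e N] abs_ge_self le_less_trans
      unfolding real_norm_def by metis
    have "norm ((\<Sum>i<n. frechet_derivative (G i) (at x) h) - D x h) \<le> e * norm h"
      if "n0 \<le> n" "x \<in> S" for n x h
    proof -
      let ?d = "\<lambda>i. frechet_derivative (G i) (at x) h"
      have "D x h = (\<Sum>i. ?d (i + n)) + (\<Sum>i<n. ?d i)"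
        unfolding D_def
        using sums_summable[OF sumD[OF that(2)]] by (rule suminf_split_initial_segment)
      then have "norm ((\<Sum>i<n. ?d i) - D x h) = norm (\<Sum>i. ?d (i + n))" by simp
      also have "\<dots> \<le> (\<Sum>i. N (i + n) * norm h)"
      proof (rule norm_suminf_le)
        show "norm (?d (i + n)) \<le> N (i + n) * norm h" for i
          using le[OF that(2)] by simp
      qed (intro summable_mult2 summable_ignore_initial_segment N)
      also have "\<dots> = (\<Sum>i. N (i + n)) * norm h"
        by (intro suminf_mult2[symmetric] summable_ignore_initial_segment N)
      also have "\<dots> \<le> e * norm h"
        using n0[OF that(1)] by (intro mult_right_mono) auto
      finally show ?thesis .
    qed
    then show ?thesis
      unfolding eventually_sequentially by blast
  qed
  have F: "(F has_derivative D x) (at x)" if x: "x \<in> S" for x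
  proof -
    have "\<exists>g. \<forall>x\<in>S. (\<lambda>n. G n x) sums g x \<and> (g has_derivative D x) (at x within S)"
    proof (rule has_derivative_series[where f = G and g' = D and x = x and
          f' = "\<lambda>n x. frechet_derivative (G n) (at x)",
          OF S(2) _ unif x Suc.prems(3)[OF x]])
      show "(G n has_derivative frechet_derivative (G n) (at x)) (at x within S)" for n x
        using dG by (subst (asm) frechet_derivative_works) (rule has_derivative_at_withinI)
    qed
    then obtain g where g: "\<And>x. x \<in> S \<Longrightarrow> (\<lambda>n. G n x) sums g x"
      "\<And>x. x \<in> S \<Longrightarrow> (g has_derivative D x) (at x within S)" by blast
    have "(g has_derivative D x) (at x)"
      using g(2)[OF x] at_within_open[OF x S(1)] by simp
    then show ?thesis
      by (rule has_derivative_transform_within_open[OF _ S(1) x])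
        (rule sums_unique2[OF g(1) Suc.prems(3)])
  qed
  have "Ck_on k S (\<lambda>x. D x v)" for v
  proof (rule Suc.IH)
    show "\<exists>d. poly_fun d (\<lambda>x. frechet_derivative (G n) (at x) v)" for n
      using Suc.prems(1) poly_fun_frechet_derivative by blast
    show "\<exists>M. summable M \<and>
        (\<forall>n. \<forall>x\<in>S. \<bar>iter_deriv vs (\<lambda>x. frechet_derivative (G n) (at x) v) x\<bar> \<le> M n)"
      if "length vs \<le> k" for vs
      using Suc.prems(2)[of "v # vs"] that by simp
  qed (rule sumD)
  then have "Ck_on k S (\<lambda>x. frechet_derivative F (at x) v)" for v
    by (rule Ck_on_cong[OF S(1), rotated]) (simp add: frechet_derivative_at[OF F])
  with F show ?case by (auto simp: differentiable_def)
qed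

section \<open>Smoothness of the spectral extension\<close>

lemma symmetric_mat_inner:
  fixes A :: "real^'n^'n"
  assumes "symmetric_mat A"
  shows "v \<bullet> (A *v w) = (A *v v) \<bullet> w"
  using assms unfolding symmetric_mat_def
  by (metis dot_lmul_matrix vector_transpose_matrix)

text \<open>A maximiser \<open>u\<close> of the Rayleigh quotient on the unit sphere of \<open>S\<close> is an eigenvector.\<close>

lemma symmetric_mat_eigenvector:
  fixes A :: "real^'n^'n"
  assumes A: "symmetric_mat A" and S: "subspace S" "\<And>v. v \<in> S \<Longrightarrow> A *v v \<in> S" "S \<noteq> {0}"
  obtains u c where "u \<in> S" "norm u = 1" "A *v u = c *\<^sub>R u"
proof -
  obtain s where s: "s \<in> S" "s \<noteq> 0" using S(1,3) subspace_0 by blast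
  let ?K = "S \<inter> sphere 0 1"
  have "s /\<^sub>R norm s \<in> ?K" using s S(1) by (simp add: subspace_scale)
  moreover have "compact ?K" using closed_subspace[OF S(1)] by (intro closed_Int_compact) auto
  moreover have "continuous_on ?K (\<lambda>v. v \<bullet> (A *v v))"
    by (intro continuous_intros linear_continuous_on matrix_vector_mul_bounded_linear)
  ultimately obtain u where u: "u \<in> ?K" and max: "\<And>v. v \<in> ?K \<Longrightarrow> v \<bullet> (A *v v) \<le> u \<bullet> (A *v u)"
    using continuous_attains_sup[of ?K "\<lambda>v. v \<bullet> (A *v v)"] by blast
  define c where "c = u \<bullet> (A *v u)"
  define q where "q v = c * (v \<bullet> v) - v \<bullet> (A *v v)" for v
  have q0: "0 \<le> q v" if "v \<in> S" for v
  proof (cases "v = 0")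
    case False
    then have "v /\<^sub>R norm v \<in> ?K" using that S(1) by (simp add: subspace_scale)
    from max[OF this] have "(v \<bullet> (A *v v)) / (norm v)\<^sup>2 \<le> c"
      by (simp add: c_def matrix_vector_mult_scaleR power2_eq_square divide_inverse mult_ac)
    then show ?thesis
      using False by (simp add: q_def dot_square_norm divide_le_eq)
  qed (simp add: q_def)
  have uu: "u \<bullet> u = 1" using u by (simp add: dot_square_norm)
  \<comment> \<open>Half the gradient of \<open>q\<close> at \<open>u\<close>, where
    \<open>q\<close> attains its minimum 0 over \<open>S\<close>.\<close>
  define w where "w = c *\<^sub>R u - A *v u"
  have w: "w \<in> S" using u S by (auto simp: w_def intro!: subspace_diff subspace_scale)
  have ww: "w \<bullet> w = c * (u \<bullet> w) - u \<bullet> (A *v w)"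
    by (simp add: symmetric_mat_inner[OF A]) (simp add: w_def inner_diff_left)
  have "w \<bullet> w \<le> 0"
  proof (rule ccontr)
    assume "\<not> w \<bullet> w \<le> 0"
    \<comment> \<open>With this step size the quadratic term of \<open>q (u - t *\<^sub>R w)\<close>
      is at most \<open>t * (w \<bullet> w)\<close>, half of what the linear term takes away, so
      \<open>q\<close> would become negative.\<close>
    define t where "t = (w \<bullet> w) / (\<bar>q w\<bar> + 1)"
    have t: "0 < t" using \<open>\<not> w \<bullet> w \<le> 0\<close> unfolding t_def by (intro divide_pos_pos) auto
    have "q (u - t *\<^sub>R w) = - 2 * t * (w \<bullet> w) + t\<^sup>2 * q w"
    proof -
      have "w \<bullet> (A *v u) = u \<bullet> (A *v w)" by (metis symmetric_mat_inner[OF A] inner_commute)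
      then show ?thesis
        unfolding ww by (simp add: q_def matrix_vector_mult_diff_distrib matrix_vector_mult_scaleR
            inner_diff_left inner_diff_right uu inner_commute[of w u] power2_eq_square algebra_simps
            flip: c_def)
    qed
    moreover have "0 \<le> q (u - t *\<^sub>R w)"
      using u w S(1) by (intro q0 subspace_diff subspace_scale) auto
    moreover have "t * q w \<le> w \<bullet> w"
    proof -
      have "t * q w \<le> t * (\<bar>q w\<bar> + 1)" using t by (intro mult_left_mono) auto
      then show ?thesis by (simp add: t_def)
    qed
    then have "t * (t * q w) \<le> t * (w \<bullet> w)" using t by (intro mult_left_mono) auto
    moreover have "0 < t * (w \<bullet> w)" using t \<open>\<not> w \<bullet> w \<le> 0\<close> by (intro mult_pos_pos) auto
    ultimately show False by (simp add: power2_eq_square mult.assoc)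
  qed
  then have "w = 0" by (metis inner_eq_zero_iff inner_ge_zero order.antisym)
  then have "A *v u = c *\<^sub>R u" by (simp add: w_def)
  with u that[of u c] show thesis by simp
qed

text \<open>Induction on the dimension: after a unit eigenvector \<open>u\<close> is split off,
  symmetry makes the orthogonal complement of \<open>u\<close> in \<open>S\<close> invariant. Hence
  the form with invariant subspaces instead of the whole space.\<close>

lemma symmetric_mat_eigenbasis:
  fixes A :: "real^'n^'n"
  assumes A: "symmetric_mat A" and S: "subspace S" "\<And>v. v \<in> S \<Longrightarrow> A *v v \<in> S"
  shows "\<exists>B. pairwise orthogonal B \<and> (\<forall>b\<in>B. norm b = 1 \<and> (\<exists>c. A *v b = c *\<^sub>R b)) \<and> span B = S"
  using S
proof (induction "dim S" arbitrary: S rule: less_induct)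
  case less
  show ?case
  proof (cases "S = {0}")
    case True
    then show ?thesis by (intro exI[of _ "{}"]) auto
  next
    case False
    obtain u c where u: "u \<in> S" "norm u = 1" "A *v u = c *\<^sub>R u"
      using symmetric_mat_eigenvector[OF A less.prems False] by blast
    define T where "T = S \<inter> {v. u \<bullet> v = 0}"
    have T: "subspace T"
      unfolding T_def by (intro subspace_inter less.prems subspace_hyperplane)
    have uT: "u \<notin> T" using u by (auto simp: T_def)
    have "T \<subseteq> S" by (auto simp: T_def)
    with u(1) uT have "T \<subset> S" by blast
    then have "dim T < dim S"
      using T less.prems(1) by (metis dim_psubset span_eq_iff)
    moreover have "A *v v \<in> T" if "v \<in> T" for v
      using that less.prems(2) by (simp add: T_def symmetric_mat_inner[OF A] u)
    ultimately obtain B where B: "pairwise orthogonal B"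
      "\<And>b. b \<in> B \<Longrightarrow> norm b = 1 \<and> (\<exists>c. A *v b = c *\<^sub>R b)" "span B = T"
      using less.hyps[of T] T by blast
    have "pairwise orthogonal (insert u B)"
      using B span_superset[of B] by (auto simp: pairwise_insert T_def orthogonal_def inner_commute)
    moreover have "span (insert u B) = S"
    proof
      show "span (insert u B) \<subseteq> S"
        using B(3) u(1) less.prems(1) span_superset[of B] by (intro span_minimal) (auto simp: T_def)
      show "S \<subseteq> span (insert u B)"
      proof
        fix v assume "v \<in> S"
        then have "v - (u \<bullet> v) *\<^sub>R u \<in> T"
          using u less.prems(1)
          by (auto simp: T_def inner_diff_right dot_square_norm intro!: subspace_diff subspace_scale)
        then show "v \<in> span (insert u B)"
          using B(3) by (auto simp: span_insert)
      qed
    qed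
    ultimately show ?thesis
      using B(2) u by (intro exI[of _ "insert u B"]) auto
  qed
qed

text \<open>An orthonormal eigenbasis has \<open>CARD('n)\<close> elements, so a bijection with the
  index type lists it as the columns of \<open>Q\<close>.\<close>

lemma symmetric_mat_diagonalization:
  fixes A :: "real^'n^'n"
  assumes A: "symmetric_mat A"
  obtains Q d where "orthogonal_matrix Q" "A = Q ** diag_mat d ** transpose Q"
proof -
  obtain B where B: "pairwise orthogonal B"
    "\<And>b. b \<in> B \<Longrightarrow> norm b = 1 \<and> (\<exists>c. A *v b = c *\<^sub>R b)" "span B = UNIV"
    using symmetric_mat_eigenbasis[OF A subspace_UNIV] by blast
  have "0 \<notin> B" using B(2) by force
  then have "independent B" using B(1) by (intro pairwise_orthogonal_independent)
  then have "finite B" by (rule independent_imp_finite)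
  moreover have "card B = CARD('n)"
    using dim_eq_card_independent[OF \<open>independent B\<close>] dim_span[of B] B(3)
    by (simp add: dim_UNIV)
  ultimately obtain h where h: "bij_betw h (UNIV :: 'n set) B"
    using finite_same_card_bij[of "UNIV :: 'n set" B] by auto
  then have hB: "h j \<in> B" for j by (auto simp: bij_betw_def)
  define Q :: "real^'n^'n" where "Q = (\<chi> i j. h j $ i)"
  have col: "column j Q = h j" for j by (simp add: Q_def column_def)
  have "\<forall>j. \<exists>c. A *v h j = c *\<^sub>R h j" using B(2) hB by blast
  then obtain c where c: "\<And>j. A *v h j = c j *\<^sub>R h j" by metis
  have "orthogonal (h i) (h j)" if "i \<noteq> j" for i j
    using that h B(1) hB by (metis bij_betw_imp_inj_on injD pairwiseD)
  then have Q: "orthogonal_matrix Q"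
    using B(2) hB by (simp add: orthogonal_matrix_orthonormal_columns col)
  have "(A ** Q) $ i $ j = (Q ** diag_mat (\<chi> i. c i)) $ i $ j" for i j
  proof -
    have "(A ** Q) $ i $ j = (A *v h j) $ i"
      by (simp add: matrix_matrix_mult_def matrix_vector_mult_def Q_def)
    then show ?thesis by (simp add: c matrix_mult_diag Q_def)
  qed
  then have "A ** Q = Q ** diag_mat (\<chi> i. c i)" by (simp add: vec_eq_iff)
  then have "A = Q ** diag_mat (\<chi> i. c i) ** transpose Q"
    using Q by (metis matrix_mul_assoc matrix_mul_rid orthogonal_matrix_def)
  with Q that show thesis by blast
qed

section \<open>The spectral extension in coordinates and its dependence on the scalar
  function\<close>

lemma conj_diag_component:
  fixes Q :: "real^'n^'n"
  shows
  "(Q ** diag_mat d ** transpose Q) $ i $ j = (\<Sum>k\<in>UNIV. Q $ i $ k * d $ k * Q $ j $ k)"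
  by (simp add: matrix_mult_diag) (simp add: matrix_matrix_mult_def transpose_def)

lemma spectral_ext_component:
  fixes Q :: "real^'n^'n"
  assumes "orthogonal_matrix Q"
  shows "spectral_ext a (Q ** diag_mat d ** transpose Q) $ i $ j =
    (\<Sum>k\<in>UNIV. Q $ i $ k * a (d $ k) * Q $ j $ k)"
  by (simp add: spectral_ext_eq[OF assms] conj_diag_component)

lemma symmetric_mat_spectral_ext:
  fixes A :: "real^'n^'n"
  assumes "symmetric_mat A"
  shows "symmetric_mat (spectral_ext a A)"
proof -
  obtain Q d where Q: "orthogonal_matrix Q" "A = Q ** diag_mat d ** transpose Q"
    using assms by (rule symmetric_mat_diagonalization)
  have "transpose (diag_mat e) = diag_mat e" for e :: "real^'n"
    by (simp add: diag_mat_def transpose_def vec_eq_iff)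
  then show ?thesis
    by (simp add: Q(2) symmetric_mat_def spectral_ext_eq[OF Q(1)] matrix_transpose_mul matrix_mul_assoc)
qed

text \<open>The matrix norm here is the Frobenius norm, so Cauchy-Schwarz in each row
  suffices.\<close>

lemma norm_matrix_vector_mult_le:
  fixes A :: "real^'n^'m"
  shows "norm (A *v x) \<le> norm A * norm x"
proof -
  have "norm (A *v x) = L2_set (\<lambda>i. A $ i \<bullet> x) UNIV"
    by (simp add: norm_vec_def matrix_vector_mul_component L2_set_def)
  also have "\<dots> = L2_set (\<lambda>i. \<bar>A $ i \<bullet> x\<bar>) UNIV" by (simp add: L2_set_def)
  also have "\<dots> \<le> L2_set (\<lambda>i. norm (A $ i) * norm x) UNIV"
    by (intro L2_set_mono Cauchy_Schwarz_ineq2) auto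
  also have "\<dots> = norm A * norm x"
    by (simp add: norm_vec_def L2_set_left_distrib)
  finally show ?thesis .
qed

text \<open>Both extensions share \<open>Q\<close>, so each entry of the difference is a sum of
  \<open>CARD('n)\<close> terms, one per column of \<open>Q\<close>. Entries of an orthogonal matrix
  are at most 1 in absolute value, and so are the eigenvalues relative to
  \<open>norm A\<close>.\<close>

lemma spectral_ext_diff_le:
  fixes A :: "real^'n^'n" and e :: real
  assumes A: "symmetric_mat A" "norm A \<le> R" and e: "\<And>t. \<bar>t\<bar> \<le> R \<Longrightarrow> \<bar>a t - b t\<bar> \<le> e"
  shows "\<bar>spectral_ext a A $ i $ j - spectral_ext b A $ i $ j\<bar> \<le> CARD('n) * e"
proof -
  obtain Q d where Q: "orthogonal_matrix Q" "A = Q ** diag_mat d ** transpose Q"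
    using A(1) by (rule symmetric_mat_diagonalization)
  have col: "norm (column k Q) = 1" for k
    using Q(1) by (simp add: orthogonal_matrix_orthonormal_columns)
  have Q1: "\<bar>Q $ i $ k\<bar> \<le> 1" for i k
    using component_le_norm_cart[of "column k Q" i] col by (simp add: column_def)
  have "\<bar>d $ k\<bar> \<le> R" for k
  proof -
    have "A ** Q = Q ** diag_mat d"
      using Q by (metis matrix_mul_assoc matrix_mul_rid orthogonal_matrix_def)
    then have "(A *v column k Q) $ i = (d $ k *\<^sub>R column k Q) $ i" for i
      by (simp add: vec_eq_iff matrix_mult_diag)
        (simp add: matrix_matrix_mult_def matrix_vector_mult_def column_def mult.commute)
    then have "A *v column k Q = d $ k *\<^sub>R column k Q" by (simp add: vec_eq_iff)
    then have "\<bar>d $ k\<bar> \<le> norm A"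
      using norm_matrix_vector_mult_le[of A "column k Q"] col by simp
    with A(2) show ?thesis by simp
  qed
  then have "\<bar>Q $ i $ k * (a (d $ k) - b (d $ k)) * Q $ j $ k\<bar> \<le> 1 * e * 1" for k
    unfolding abs_mult using Q1 e by (intro mult_mono) (auto intro: order.trans[OF abs_ge_zero e])
  then have "\<bar>\<Sum>k\<in>UNIV. Q $ i $ k * (a (d $ k) - b (d $ k)) * Q $ j $ k\<bar> \<le> (\<Sum>k::'n\<in>UNIV. e)"
    by (intro order.trans[OF sum_abs] sum_mono) simp
  then show ?thesis
    by (simp add: Q(2) spectral_ext_component[OF Q(1)] algebra_simps sum_subtractf)
qed

section \<open>Matrix polynomials and smoothness of the spectral extension\<close>

primrec mat_pow :: "real^'n^'n \<Rightarrow> nat \<Rightarrow> real^'n^'n" where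
  "mat_pow A 0 = mat 1"
| "mat_pow A (Suc k) = A ** mat_pow A k"

lemma mat_pow_conj_diag:
  fixes Q :: "real^'n^'n"
  assumes "orthogonal_matrix Q"
  shows "mat_pow (Q ** diag_mat d ** transpose Q) k = Q ** diag_mat (\<chi> i. d $ i ^ k) ** transpose Q"
proof (induction k)
  case 0
  have "Q ** diag_mat (\<chi> i. 1) = Q" by (simp add: matrix_mult_diag vec_eq_iff)
  with assms show ?case by (simp add: orthogonal_matrix_def)
next
  case (Suc k)
  have D: "diag_mat d ** diag_mat (\<chi> i. d $ i ^ k) = diag_mat (\<chi> i. d $ i ^ Suc k)"
    by (simp add: matrix_mult_diag) (simp add: diag_mat_def vec_eq_iff)
  have "mat_pow (Q ** diag_mat d ** transpose Q) (Suc k) =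
      Q ** diag_mat d ** transpose Q ** (Q ** diag_mat (\<chi> i. d $ i ^ k) ** transpose Q)"
    by (simp only: mat_pow.simps Suc)
  also have "\<dots> = Q ** diag_mat d ** (transpose Q ** Q) ** diag_mat (\<chi> i. d $ i ^ k) ** transpose Q"
    by (simp only: matrix_mul_assoc)
  also have "transpose Q ** Q = mat 1" using assms by (simp add: orthogonal_matrix_def)
  also have "Q ** diag_mat d ** mat 1 ** diag_mat (\<chi> i. d $ i ^ k) ** transpose Q =
      Q ** (diag_mat d ** diag_mat (\<chi> i. d $ i ^ k)) ** transpose Q"
    by (simp only: matrix_mul_rid matrix_mul_assoc)
  finally show ?case unfolding D .
qed

text \<open>Frees the spectral extension of a polynomial from \<open>Q\<close> and \<open>d\<close>,
  which need not depend continuously on \<open>A\<close>: what remains is a matrix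
  polynomial.\<close>

lemma spectral_ext_poly:
  assumes A: "symmetric_mat A" and p: "degree p \<le> n"
  shows "spectral_ext (poly p) A $ i $ j = (\<Sum>m\<le>n. coeff p m * mat_pow A m $ i $ j)"
proof -
  obtain Q d where Q: "orthogonal_matrix Q" "A = Q ** diag_mat d ** transpose Q"
    using A by (rule symmetric_mat_diagonalization)
  have "poly p t = (\<Sum>m\<le>n. coeff p m * t ^ m)" for t
    by (subst poly_as_sum_of_monoms'[OF p, symmetric]) (simp add: poly_sum poly_monom)
  then have "spectral_ext (poly p) A $ i $ j =
      (\<Sum>k\<in>UNIV. \<Sum>m\<le>n. Q $ i $ k * (coeff p m * d $ k ^ m) * Q $ j $ k)"
    by (simp add: Q(2) spectral_ext_component[OF Q(1)] sum_distrib_left sum_distrib_right)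
  also have "\<dots> = (\<Sum>m\<le>n. coeff p m * mat_pow A m $ i $ j)"
    by (subst sum.swap) (simp add: Q(2) mat_pow_conj_diag[OF Q(1)] conj_diag_component
        sum_distrib_left mult_ac)
  finally show ?thesis .
qed

text \<open>
  \<open>spectral_ext\<close> is junk off the symmetric matrices; precomposing with \<open>sym_part\<close> gives a map that is
  smooth on the whole matrix space.
\<close>

definition sym_part :: "real^'n^'n \<Rightarrow> real^'n^'n" where
  "sym_part A = (1 / 2) *\<^sub>R (A + transpose A)"

lemma symmetric_sym_part: "symmetric_mat (sym_part A)"
  by (simp add: symmetric_mat_def sym_part_def transpose_def vec_eq_iff)

lemma sym_part_symmetric: "symmetric_mat A \<Longrightarrow> sym_part A = A"
  by (simp add: symmetric_mat_def sym_part_def flip: scaleR_2)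

lemma norm_sym_part_le: "norm (sym_part A) \<le> norm A"
proof -
  have "norm (transpose A) = norm A"
    unfolding norm_eq_sqrt_inner by (simp add: inner_vec_def transpose_def) (rule sum.swap)
  then show ?thesis
    using norm_triangle_ineq[of A "transpose A"] by (simp add: sym_part_def)
qed

lemma bounded_linear_sym_part_component:
  "bounded_linear (\<lambda>A :: real^'n^'n. sym_part A $ i $ j)"
proof -
  have "bounded_linear (\<lambda>A :: real^'n^'n. A $ i $ j)" for i j
    by (rule bounded_linear_compose[OF bounded_linear_vec_nth bounded_linear_vec_nth])
  then have "bounded_linear (\<lambda>A :: real^'n^'n. (1 / 2) *\<^sub>R (A $ i $ j + A $ j $ i))"
    by (intro bounded_linear_compose[OF bounded_linear_scaleR_right] bounded_linear_add)
  then show ?thesis by (simp add: sym_part_def transpose_def)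
qed

text \<open>Each further matrix factor contributes one linear form to every summand, the shape of
  \<open>poly_fun.times\<close>.\<close>

lemma poly_fun_mat_pow: "poly_fun m (\<lambda>A. mat_pow (sym_part A) m $ i $ j)"
proof (induction m arbitrary: i j)
  case 0
  show ?case by (simp add: poly_fun.const)
next
  case (Suc m)
  show ?case
    unfolding mat_pow.simps matrix_matrix_mult_def vec_lambda_beta
    by (intro poly_fun_sum poly_fun.times Suc bounded_linear_sym_part_component) simp
qed

lemma poly_fun_spectral_ext:
  assumes "degree p \<le> n"
  shows "poly_fun n (\<lambda>A. spectral_ext (poly p) (sym_part A) $ i $ j)"
  unfolding spectral_ext_poly[OF symmetric_sym_part assms]
  by (intro poly_fun_sum poly_fun_scale) (auto intro: poly_fun_mono[OF poly_fun_mat_pow])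

lemma poly_fun_iter_deriv: "poly_fun n f \<Longrightarrow> poly_fun n (iter_deriv vs f)"
  by (induction vs arbitrary: f) (simp_all add: poly_fun_frechet_derivative)

lemma poly_fun_bounded_on_ball:
  fixes f :: "'a::euclidean_space \<Rightarrow> real"
  assumes "poly_fun n f"
  obtains B where "\<And>x. x \<in> ball 0 R \<Longrightarrow> \<bar>f x\<bar> \<le> B"
proof -
  have "continuous_on (cball 0 R) f"
    using poly_fun_differentiable[OF assms]
    by (intro continuous_at_imp_continuous_on ballI differentiable_imp_continuous_within)
  then have "bounded (f ` cball 0 R)"
    by (intro compact_imp_bounded compact_continuous_image) auto
  then obtain B where B: "\<forall>y\<in>f ` cball 0 R. norm y \<le> B" unfolding bounded_iff by blast
  show thesis
  proof (rule that)
    fix x :: 'a assume "x \<in> ball 0 R"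
    with B show "\<bar>f x\<bar> \<le> B" by simp
  qed
qed

text \<open>With error rate \<open>2 * k + 2\<close>, up to \<open>k\<close> derivatives, each
  costing a quadratic factor in the degree, leave a telescoping series dominated by inverse squares.
  The approximations may depend on \<open>k\<close> and \<open>R\<close>, since each order and each
  ball is treated on its own.\<close>

lemma smooth_map_spectral_ext:
  fixes a :: "real \<Rightarrow> real" and i j :: "'n::finite"
  assumes a: "smooth_map a"
  shows "smooth_map (\<lambda>A. spectral_ext a (sym_part A) $ i $ j)"
  unfolding smooth_map_def
proof (intro allI Ck_map_if_Ck_on_balls)
  fix k :: nat and R :: real assume R: "0 < R"
  \<comment> \<open>Room for the unit of radius lost with each of up to \<open>k\<close>
    derivatives.\<close>
  define R' where "R' = R + k"
  have "0 < R'" using R by (simp add: R'_def)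
  let ?F = "\<lambda>A :: real^'n^'n. spectral_ext a (sym_part A) $ i $ j"
  obtain C where C: "C \<ge> 0" "\<And>n. \<exists>p. degree p \<le> n \<and>
      (\<forall>x. \<bar>x\<bar> \<le> R' \<longrightarrow> \<bar>a x - poly p x\<bar> \<le> C / real (Suc n) ^ (2 * k + 2))"
    using smooth_map_rapid_approx[OF a \<open>0 < R'\<close>, of "2 * k + 2"] by blast
  then obtain p where p: "\<And>n. degree (p n) \<le> n"
    "\<And>n x. \<bar>x\<bar> \<le> R' \<Longrightarrow> \<bar>a x - poly (p n) x\<bar> \<le> C / real (Suc n) ^ (2 * k + 2)"
    by metis
  define F where "F n A = spectral_ext (poly (p n)) (sym_part A) $ i $ j" for n and A :: "real^'n^'n"
  define c where "c = CARD('n) * C"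
  have c: "0 \<le> c" using C by (simp add: c_def)
  have F: "poly_fun n (F n)" for n
    unfolding F_def by (rule poly_fun_spectral_ext[OF p(1)])
  have err: "\<bar>?F A - F n A\<bar> \<le> c / real (Suc n) ^ (2 * k + 2)" if "norm A < R'" for A n
  proof -
    have "norm (sym_part A) \<le> R'" using norm_sym_part_le[of A] that by simp
    from spectral_ext_diff_le[OF symmetric_sym_part this p(2)] show ?thesis
      unfolding F_def c_def by simp
  qed
  \<comment> \<open>Taking \<open>F 0\<close> as term 0 makes the sum of the terms up to
    \<open>m\<close> equal to \<open>F m\<close>.\<close>
  define G where "G n = (case n of 0 \<Rightarrow> F 0 | Suc m \<Rightarrow> (\<lambda>A. F (Suc m) A - F m A))" for n
  have G_Suc: "G (Suc m) = (\<lambda>A. F (Suc m) A - F m A)" and G_0: "G 0 = F 0" for m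
    by (simp_all add: G_def)
  have G: "poly_fun n (G n)" for n
  proof (cases n)
    case (Suc m)
    then show ?thesis by (simp add: G_Suc poly_fun_diff[OF F poly_fun_Suc[OF F]])
  qed (simp add: G_0 F)
  have G_le: "\<bar>G (Suc m) A\<bar> \<le> 2 * c / real (Suc m) ^ (2 * k + 2)" if "norm A < R'" for A m
  proof -
    have "c / real (Suc (Suc m)) ^ (2 * k + 2) \<le> c / real (Suc m) ^ (2 * k + 2)"
      using c by (intro divide_left_mono power_mono mult_pos_pos zero_less_power) auto
    then show ?thesis
      using err[OF that, of m] err[OF that, of "Suc m"] unfolding G_Suc by linarith
  qed
  show "Ck_on k (ball 0 R) ?F"
  proof (rule Ck_on_series[of "ball 0 R" G])
    show "\<exists>d. poly_fun d (G n)" for n using G by blast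
    show "(\<lambda>n. G n A) sums ?F A" if "A \<in> ball 0 R" for A
    proof -
      have sum: "(\<Sum>n<Suc m. G n A) = F m A" for m
        by (induction m) (simp_all add: G_0 G_Suc)
      have lim: "(\<lambda>m. c / real (Suc m) ^ (2 * k + 2)) \<longlonglongrightarrow> 0"
        by (intro tendsto_divide_0[OF tendsto_const] filterlim_at_top_imp_at_infinity
            filterlim_pow_at_top filterlim_compose[OF filterlim_real_sequentially filterlim_Suc]) auto
      have le: "norm (F m A - ?F A) \<le> c / real (Suc m) ^ (2 * k + 2)" for m
        using err[of A m] that R by (simp add: R'_def abs_minus_commute)
      have "(\<lambda>m. F m A - ?F A) \<longlonglongrightarrow> 0"
        by (rule Lim_null_comparison[OF always_eventually[OF allI[OF le]] lim])
      then have "(\<lambda>m. \<Sum>n<Suc m. G n A) \<longlonglongrightarrow> ?F A"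
        unfolding sum by (simp add: LIM_zero_iff)
      then show ?thesis unfolding sums_def by (rule LIMSEQ_imp_Suc)
    qed
    fix vs :: "(real^'n^'n) list" assume vs: "length vs \<le> k"
    obtain B where B: "\<And>A. A \<in> ball 0 R \<Longrightarrow> \<bar>iter_deriv vs (G 0) A\<bar> \<le> B"
      using poly_fun_bounded_on_ball[OF poly_fun_iter_deriv[OF G[of 0], of vs], where R = R] by blast
    define P where "P = prod_list (map norm vs)"
    have P: "0 \<le> P" unfolding P_def by (intro prod_list_nonneg) auto
    \<comment> \<open>Term 0 gets the separate bound \<open>B\<close>. For the others,
      \<open>3 ^ (2 * k)\<close> comes from \<open>2 * y + 1 \<le> 3 * y\<close> for
      \<open>y \<ge> 1\<close>, and two powers of \<open>Suc m\<close> survive in the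
      denominator.\<close>
    define M where "M n = (case n of 0 \<Rightarrow> B | Suc m \<Rightarrow> 3 ^ (2 * k) * (2 * c) * P * inverse (real (Suc m) ^ 2))" for n
    have "summable (\<lambda>m. inverse (real (Suc m) ^ 2))"
      using inverse_power_summable[of 2, where 'a = real] by (subst summable_Suc_iff) simp
    then have "summable (\<lambda>m. M (Suc m))" unfolding M_def by (simp add: summable_mult del: of_nat_Suc)
    then have "summable M" by (simp only: summable_Suc_iff)
    moreover have "\<bar>iter_deriv vs (G n) A\<bar> \<le> M n" if A: "A \<in> ball 0 R" for n A
    proof (cases n)
      case 0
      then show ?thesis using B[OF A] by (simp add: M_def)
    next
      case (Suc m)
      let ?x = "real (Suc m)" and ?l = "2 * length vs"
      have "\<bar>iter_deriv vs (G (Suc m)) A\<bar> \<le> (2 * ?x + 1) ^ ?l * (2 * c / ?x ^ (2 * k + 2)) * P"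
        unfolding P_def
      proof (rule poly_fun_iter_deriv_le[OF G])
        show "norm A < R" using A by simp
        show "\<bar>G (Suc m) y\<bar> \<le> 2 * c / ?x ^ (2 * k + 2)" if "norm y < R + length vs" for y
          using that vs by (intro G_le) (simp add: R'_def)
      qed
      also have "\<dots> \<le> (3 * ?x) ^ (2 * k) * (2 * c / ?x ^ (2 * k + 2)) * P"
      proof -
        have "(2 * ?x + 1) ^ ?l \<le> (3 * ?x) ^ ?l" by (intro power_mono) auto
        also have "\<dots> \<le> (3 * ?x) ^ (2 * k)" using vs by (intro power_increasing) auto
        finally show ?thesis using c P by (intro mult_right_mono) auto
      qed
      also have "\<dots> = M n"
      proof -
        have "(3 * y) ^ (2 * k) * (2 * c / y ^ (2 * k + 2)) * P = 3 ^ (2 * k) * (2 * c) * P * inverse (y ^ 2)"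
          if "0 < y" for y :: real
          using that by (simp add: power_mult_distrib power_add power2_eq_square field_simps)
        from this[of ?x] show ?thesis by (simp add: Suc M_def)
      qed
      finally show ?thesis unfolding Suc .
    qed
    ultimately show "\<exists>M. summable M \<and> (\<forall>n. \<forall>A\<in>ball 0 R. \<bar>iter_deriv vs (G n) A\<bar> \<le> M n)"
      by blast
  qed auto
qed

section \<open>Lie derivatives and the matrix relative degree\<close>

text \<open>The scalar operation to which the Leibniz and chain rules apply;
  \<open>lie_deriv\<close> is this one entrywise.\<close>

definition lie :: "('a::euclidean_space \<Rightarrow> 'a) \<Rightarrow> ('a \<Rightarrow> real) \<Rightarrow> 'a \<Rightarrow> real" where
  "lie w \<phi> x = frechet_derivative \<phi> (at x) (w x)"

text \<open>Smoothness speaks of fixed directions, so the varying direction \<open>w x\<close> is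
  expanded in the basis, with smooth coefficients.\<close>

lemma smooth_map_lie:
  assumes w: "smooth_map w" and \<phi>: "smooth_map \<phi>"
  shows "smooth_map (lie w \<phi>)"
proof -
  have "frechet_derivative \<phi> (at x) (w x) =
      (\<Sum>b\<in>Basis. (w x \<bullet> b) *\<^sub>R frechet_derivative \<phi> (at x) b)" for x
    by (rule frechet_derivative_basis[OF smooth_map_differentiable[OF \<phi>]])
  then have "lie w \<phi> = (\<lambda>x. \<Sum>b\<in>Basis. (w x \<bullet> b) * frechet_derivative \<phi> (at x) b)"
    by (simp add: lie_def fun_eq_iff)
  then show ?thesis
    using smooth_map_bounded_linear[OF bounded_linear_inner_left w]
    by (auto intro!: smooth_map_sum smooth_map_mult smooth_map_frechet_derivative \<phi>)
qed

lemma lie_add: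
  "smooth_map \<phi> \<Longrightarrow> smooth_map \<psi> \<Longrightarrow> lie w (\<lambda>x. \<phi> x + \<psi> x) = (\<lambda>x. lie w \<phi> x + lie w \<psi> x)"
  by (simp add: lie_def fun_eq_iff frechet_derivative_add smooth_map_differentiable)

lemma lie_mult:
  "smooth_map \<phi> \<Longrightarrow> smooth_map \<psi> \<Longrightarrow>
    lie w (\<lambda>x. \<phi> x * \<psi> x) = (\<lambda>x. \<phi> x * lie w \<psi> x + lie w \<phi> x * \<psi> x)"
  by (simp add: lie_def fun_eq_iff frechet_derivative_mult smooth_map_differentiable)

lemma lie_const: "lie w (\<lambda>_. c) = (\<lambda>_. 0)"
  by (simp add: lie_def fun_eq_iff)

lemma lie_compose:
  fixes F :: "'b::euclidean_space \<Rightarrow> real"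
  assumes "smooth_map F" "\<And>b. b \<in> Basis \<Longrightarrow> smooth_map (\<lambda>x. \<Phi> x \<bullet> b)"
  shows "lie w (\<lambda>x. F (\<Phi> x)) =
    (\<lambda>x. \<Sum>b\<in>Basis. lie w (\<lambda>x. \<Phi> x \<bullet> b) x * frechet_derivative F (at (\<Phi> x)) b)"
  using assms
  by (simp add: lie_def fun_eq_iff frechet_derivative_compose_basis smooth_map_differentiable)

text \<open>
  \<open>lie_null f W s \<phi>\<close> says that \<open>L\<^sub>w L\<^sub>f\<^sup>k \<phi>\<close> vanishes identically for all \<open>k < s\<close> and \<open>w \<in> W\<close>.
\<close>

primrec lie_null :: "('a::euclidean_space \<Rightarrow> 'a) \<Rightarrow> ('a \<Rightarrow> 'a) set \<Rightarrow> nat \<Rightarrow> ('a \<Rightarrow> real) \<Rightarrow> bool" where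
  "lie_null f W 0 \<phi> \<longleftrightarrow> smooth_map \<phi>"
| "lie_null f W (Suc s) \<phi> \<longleftrightarrow>
     smooth_map \<phi> \<and> (\<forall>w\<in>W. lie w \<phi> = (\<lambda>_. 0)) \<and> lie_null f W s (lie f \<phi>)"

section \<open>The algebra of functions whose mixed Lie derivatives vanish up to a given
  order\<close>

lemma lie_null_smooth: "lie_null f W s \<phi> \<Longrightarrow> smooth_map \<phi>"
  by (cases s) auto

lemma lie_null_SucD: "lie_null f W (Suc s) \<phi> \<Longrightarrow> lie_null f W s \<phi>"
  by (induction s arbitrary: \<phi>) auto

lemma lie_null_const: "lie_null f W s (\<lambda>_. c)"
  by (induction s arbitrary: c) (simp_all add: smooth_map_const lie_const)

lemma lie_null_add:
  "lie_null f W s \<phi> \<Longrightarrow> lie_null f W s \<psi> \<Longrightarrow> lie_null f W s (\<lambda>x. \<phi> x + \<psi> x)"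
  by (induction s arbitrary: \<phi> \<psi>) (simp_all add: smooth_map_add lie_add)

text \<open>By the Leibniz rule, \<open>lie f\<close> of the product is a sum of products of members
  of \<open>lie_null f W s\<close>; \<open>lie_null_SucD\<close> supplies the undifferentiated
  factors.\<close>

lemma lie_null_mult:
  "lie_null f W s \<phi> \<Longrightarrow> lie_null f W s \<psi> \<Longrightarrow> lie_null f W s (\<lambda>x. \<phi> x * \<psi> x)"
proof (induction s arbitrary: \<phi> \<psi>)
  case (Suc s)
  then have "lie_null f W s \<phi>" "lie_null f W s \<psi>" by (blast dest: lie_null_SucD)+
  with Suc show ?case
    by (simp add: smooth_map_mult lie_mult lie_null_add)
qed (simp add: smooth_map_mult)

lemma lie_null_sum:
  assumes "finite I" "\<And>i. i \<in> I \<Longrightarrow> lie_null f W s (\<phi> i)"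
  shows "lie_null f W s (\<lambda>x. \<Sum>i\<in>I. \<phi> i x)"
  using assms by (induction I rule: finite_induct) (auto intro: lie_null_add lie_null_const)

lemma lie_null_diff:
  "lie_null f W s \<phi> \<Longrightarrow> lie_null f W s \<psi> \<Longrightarrow> lie_null f W s (\<lambda>x. \<phi> x - \<psi> x)"
  using lie_null_add[of f W s \<phi> "\<lambda>x. -1 * \<psi> x"] lie_null_mult[OF lie_null_const, of f W s \<psi> "-1"]
  by simp

text \<open>The chain rule turns \<open>lie f\<close> of the composition into a sum of products. The
  partial derivatives of \<open>F\<close> are again smooth, so with \<open>F\<close> generalised the
  induction hypothesis covers their compositions with \<open>\<Phi>\<close>.\<close>

lemma lie_null_compose:
  fixes F :: "'b::euclidean_space \<Rightarrow> real"
  assumes "smooth_map F" "\<And>b. b \<in> Basis \<Longrightarrow> lie_null f W s (\<lambda>x. \<Phi> x \<bullet> b)"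
  shows "lie_null f W s (\<lambda>x. F (\<Phi> x))"
  using assms
proof (induction s arbitrary: F)
  case 0
  then show ?case by (simp add: smooth_map_compose)
next
  case (Suc s)
  have sm: "b \<in> Basis \<Longrightarrow> smooth_map (\<lambda>x. \<Phi> x \<bullet> b)" for b
    using Suc.prems(2) by simp
  have "lie_null f W s (\<lambda>x. frechet_derivative F (at (\<Phi> x)) b)" for b
  proof (rule Suc.IH[where F = "\<lambda>y. frechet_derivative F (at y) b"])
    show "smooth_map (\<lambda>y. frechet_derivative F (at y) b)"
      using Suc.prems(1) by (rule smooth_map_frechet_derivative)
    show "lie_null f W s (\<lambda>x. \<Phi> x \<bullet> c)" if "c \<in> Basis" for c
      using Suc.prems(2)[OF that] by (rule lie_null_SucD)
  qed
  then have "lie_null f W s (lie f (\<lambda>x. F (\<Phi> x)))"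
    using Suc.prems(2)
    by (simp add: lie_compose[OF Suc.prems(1) sm] lie_null_sum lie_null_mult)
  moreover have "lie w (\<lambda>x. F (\<Phi> x)) = (\<lambda>_. 0)" if "w \<in> W" for w
    using Suc.prems(2) that by (simp add: lie_compose[OF Suc.prems(1) sm])
  moreover have "smooth_map (\<lambda>x. F (\<Phi> x))"
    using Suc.prems(1) sm by (rule smooth_map_compose)
  ultimately show ?case by simp
qed

lemma lie_funpow_null: "lie_null f W s \<phi> \<Longrightarrow> k < s \<Longrightarrow> w \<in> W \<Longrightarrow> lie w ((lie f ^^ k) \<phi>) = (\<lambda>_. 0)"
proof (induction s arbitrary: \<phi> k)
  case (Suc s)
  then show ?case by (cases k) (simp_all add: funpow_swap1)
qed simp

lemma smooth_map_lie_funpow: "smooth_map f \<Longrightarrow> smooth_map \<phi> \<Longrightarrow> smooth_map ((lie f ^^ k) \<phi>)"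
  by (induction k) (simp_all add: smooth_map_lie)

lemma lie_funpow_add:
  assumes "smooth_map f"
  shows "smooth_map \<phi> \<Longrightarrow> smooth_map \<psi> \<Longrightarrow>
    (lie f ^^ k) (\<lambda>x. \<phi> x + \<psi> x) = (\<lambda>x. (lie f ^^ k) \<phi> x + (lie f ^^ k) \<psi> x)"
  using assms by (induction k) (simp_all add: lie_add smooth_map_lie_funpow)

section \<open>Passage to matrix entries and symmetry of the recursive functions\<close>

lemma lie_deriv_component: "(\<lambda>x. lie_deriv w A x $ i $ j) = lie w (\<lambda>x. A x $ i $ j)"
  by (simp add: lie_deriv_def lie_def fun_eq_iff)

lemma lie_deriv_funpow_component:
  "(\<lambda>x. (lie_deriv f ^^ k) A x $ i $ j) = (lie f ^^ k) (\<lambda>x. A x $ i $ j)"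
  by (induction k) (simp_all add: lie_deriv_component)

lemma symmetric_mat_lie_deriv:
  assumes "\<And>y. symmetric_mat (A y)"
  shows "symmetric_mat (lie_deriv w A x)"
proof -
  have "A y $ i $ j = A y $ j $ i" for i j y
    using assms[of y] unfolding symmetric_mat_def transpose_def by (metis vec_lambda_beta)
  then show ?thesis by (simp add: symmetric_mat_def lie_deriv_def transpose_def)
qed

lemma symmetric_mat_add: "symmetric_mat A \<Longrightarrow> symmetric_mat B \<Longrightarrow> symmetric_mat (A + B)"
  by (simp add: symmetric_mat_def transpose_def vec_eq_iff)

text \<open>Each term of the recursion preserves symmetry. This permits replacing
  \<open>spectral_ext\<close> by its smooth version through \<open>sym_part\<close>.\<close>

lemma symmetric_mat_Psi:
  assumes "\<And>y. symmetric_mat (H y)"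
  shows "symmetric_mat (Psi f \<alpha> H i x)"
  using assms
  by (induction f \<alpha> H i arbitrary: x rule: Psi.induct)
    (simp_all add: symmetric_mat_add symmetric_mat_lie_deriv symmetric_mat_spectral_ext)

lemma Psi_Suc: "1 \<le> i \<Longrightarrow>
  Psi f \<alpha> H (Suc i) x = lie_deriv f (Psi f \<alpha> H i) x + spectral_ext (\<alpha> i) (Psi f \<alpha> H i x)"
  by (cases i) simp_all

lemma pos_def_mat_uminus: "neg_def_mat M \<Longrightarrow> pos_def_mat (- M)"
proof -
  have "(- M) *v v = - (M *v v)" for v
    by (simp add: matrix_vector_mult_def vec_eq_iff sum_negf)
  moreover have "symmetric_mat M \<Longrightarrow> symmetric_mat (- M)"
    by (simp add: symmetric_mat_def transpose_def vec_eq_iff)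
  ultimately show "neg_def_mat M \<Longrightarrow> pos_def_mat (- M)"
    by (simp add: pos_def_mat_def neg_def_mat_def)
qed

theorem proposition1:
  fixes f :: "real^'n \<Rightarrow> real^'n"
    and g :: "real^'n \<Rightarrow> real^'m^'n"
    and H :: "real^'n \<Rightarrow> real^'p^'p"
    and \<alpha> :: "nat \<Rightarrow> real \<Rightarrow> real"
    and r :: nat
    and x :: "real^'n"
    and V :: "real^'d^'p"
  assumes smooth_f: "smooth_map f"
    and smooth_g: "smooth_map g"
    and smooth_H: "smooth_map H"
    and symmetric_H: "\<And>y. symmetric_mat (H y)"
    and alpha: "\<And>i. i \<in> {1..<r} \<Longrightarrow> smooth_map (\<alpha> i) \<and> extended_class_K (\<alpha> i)"
    and r_pos: "1 \<le> r"
    and r_below: "\<And>i j y. i \<in> {1..<r} \<Longrightarrow>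
          lie_deriv (\<lambda>z. column j (g z)) (Psi f \<alpha> H i) y = 0"
    and r_level: "\<exists>j y. lie_deriv (\<lambda>z. column j (g z)) (Psi f \<alpha> H r) y \<noteq> 0"
    and V: "min_eigenbasis (Psi f \<alpha> H r x) V"
    and definite: "\<exists>j. let M = transpose V ** lie_deriv (\<lambda>z. column j (g z)) (Psi f \<alpha> H r) x ** V
          in pos_def_mat M \<or> neg_def_mat M"
  shows "has_matrix_relative_degree f g \<alpha> H r x V"
proof -
  define \<psi> where "\<psi> i a b = (\<lambda>y. Psi f \<alpha> H i y $ a $ b)" for i a b
  \<comment> \<open>The inserted \<open>sym_part\<close> acts as the identity here and exhibits
    \<open>E\<close> as a map smooth on all matrices composed with \<open>Psi\<close>.\<close>
  define E where "E i a b = (\<lambda>y. spectral_ext (\<alpha> i) (sym_part (Psi f \<alpha> H i y)) $ a $ b)" for i a b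
  define W where "W = range (\<lambda>j y. column j (g y))"
  have col: "(\<lambda>y. column j (g y)) \<in> W" for j by (simp add: W_def)
  have psi_Suc: "\<psi> (Suc i) a b = (\<lambda>y. lie f (\<psi> i a b) y + E i a b y)" if "1 \<le> i" for i a b
    using that
    by (simp add: \<psi>_def E_def Psi_Suc sym_part_symmetric[OF symmetric_mat_Psi[OF symmetric_H]]
        flip: lie_deriv_component)
  \<comment> \<open>The level \<open>s\<close> is left open: level 0 yields smoothness, higher
    levels the vanishing of Lie derivatives.\<close>
  have null_E: "lie_null f W s (E i a b)"
    if "i \<in> {1..<r}" "\<And>a b. lie_null f W s (\<psi> i a b)" for i s a b
    unfolding E_def
  proof (rule lie_null_compose[where F = "\<lambda>A. spectral_ext (\<alpha> i) (sym_part A) $ a $ b"])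
    show "smooth_map (\<lambda>A :: real^'p^'p. spectral_ext (\<alpha> i) (sym_part A) $ a $ b)"
      using alpha[OF that(1)] by (intro smooth_map_spectral_ext) simp
    fix c :: "real^'p^'p" assume "c \<in> Basis"
    \<comment> \<open>The basis consists of the matrix units, so the coordinates of
      \<open>Psi\<close> are its entries.\<close>
    then obtain k l where "c = axis k (axis l 1)"
      by (auto simp: Basis_vec_def)
    then show "lie_null f W s (\<lambda>y. Psi f \<alpha> H i y \<bullet> c)"
      using that(2)[of k l] by (simp add: \<psi>_def inner_axis)
  qed
  have smooth: "smooth_map (\<psi> i a b)" if "1 \<le> i" "i \<le> r" for i a b
    using that
  proof (induction i arbitrary: a b rule: dec_induct)
    case base
    have "bounded_linear (\<lambda>A :: real^'p^'p. A $ a $ b)"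
      by (rule bounded_linear_compose[OF bounded_linear_vec_nth bounded_linear_vec_nth])
    from smooth_map_bounded_linear[OF this smooth_H] show ?case by (simp add: \<psi>_def)
  next
    case (step i)
    then show ?case
      using null_E[of i 0] by (simp add: psi_Suc smooth_map_add smooth_map_lie smooth_f)
  qed
  \<comment> \<open>Read backwards, the recursion gives \<open>lie f (\<psi> i a b)\<close> as
    \<open>\<psi> (Suc i) a b - E i a b\<close>. Both are null at level \<open>s\<close>: the first
    because \<open>Suc i + s \<le> r\<close>, the second by \<open>null_E\<close>. The columns of
    \<open>g\<close> annihilate \<open>\<psi> i a b\<close> itself because
    \<open>i < r\<close>.\<close>
  have null: "lie_null f W s (\<psi> i a b)" if "1 \<le> i" "i + s \<le> r" for i s a b
    using that
  proof (induction s arbitrary: i a b)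
    case 0
    then show ?case by (simp add: smooth)
  next
    case (Suc s)
    have "lie_null f W s (\<lambda>y. \<psi> (Suc i) a b y - E i a b y)"
      using Suc.prems by (intro lie_null_diff Suc.IH null_E) auto
    then have "lie_null f W s (lie f (\<psi> i a b))"
      using Suc.prems by (simp add: psi_Suc)
    moreover have "lie w (\<psi> i a b) = (\<lambda>_. 0)" if "w \<in> W" for w
      using that r_below[of i] Suc.prems
      by (auto simp: W_def \<psi>_def simp flip: lie_deriv_component)
    ultimately show ?case using Suc.prems by (simp add: smooth)
  qed
  \<comment> \<open>The recursion is climbed from \<open>i\<close> to \<open>r\<close>. At each
    stage \<open>E i a b\<close> is null at level \<open>Suc m\<close>, because
    \<open>i + Suc m = r\<close>, so \<open>m\<close> Lie derivatives along \<open>f\<close>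
    followed by one along \<open>w\<close> kill it.\<close>
  have top: "lie w ((lie f ^^ m) (\<psi> i a b)) = lie w (\<psi> r a b)"
    if "w \<in> W" "1 \<le> i" "i + m = r" for w m i a b
    using that(2,3)
  proof (induction m arbitrary: i)
    case (Suc m)
    have E: "lie_null f W (Suc m) (E i a b)"
      using Suc.prems by (intro null_E null) auto
    have "lie w ((lie f ^^ m) (\<psi> (Suc i) a b)) =
        (\<lambda>y. lie w ((lie f ^^ m) (lie f (\<psi> i a b))) y + lie w ((lie f ^^ m) (E i a b)) y)"
      using Suc.prems smooth[of i] lie_null_smooth[OF E] smooth_f
      by (simp add: psi_Suc lie_funpow_add lie_add smooth_map_lie smooth_map_lie_funpow)
    also have "lie w ((lie f ^^ m) (E i a b)) = (\<lambda>_. 0)"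
      using E that(1) by (intro lie_funpow_null) auto
    finally show ?case using Suc.IH[of "Suc i"] Suc.prems by (simp add: funpow_swap1)
  qed simp
  have low: "lie_deriv (\<lambda>y. column j (g y)) ((lie_deriv f ^^ k) H) x = 0" if "k + 1 < r" for j k
  proof -
    have "lie (\<lambda>y. column j (g y)) ((lie f ^^ k) (\<psi> 1 a b)) x = 0" for a b
      using lie_funpow_null[OF null[of 1 "r - 1" a b] _ col[of j], of k] that by simp
    then show ?thesis
      by (simp add: vec_eq_iff \<psi>_def fun_cong[OF lie_deriv_component] lie_deriv_funpow_component)
  qed
  have high: "lie_deriv (\<lambda>y. column j (g y)) ((lie_deriv f ^^ (r - 1)) H) x =
      lie_deriv (\<lambda>y. column j (g y)) (Psi f \<alpha> H r) x" for j
    using top[OF col[of j], of 1 "r - 1"] r_pos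
    by (simp add: vec_eq_iff \<psi>_def fun_cong[OF lie_deriv_component] lie_deriv_funpow_component)
  obtain j where j: "pos_def_mat (transpose V ** lie_deriv (\<lambda>z. column j (g z)) (Psi f \<alpha> H r) x ** V) \<or>
      neg_def_mat (transpose V ** lie_deriv (\<lambda>z. column j (g z)) (Psi f \<alpha> H r) x ** V)"
    using definite by (auto simp: Let_def)
  let ?L = "\<lambda>j. lie_deriv (\<lambda>z. column j (g z)) (Psi f \<alpha> H r) x"
  \<comment> \<open>\<open>axis j c\<close> activates only input \<open>j\<close>; \<open>c\<close>
    will be 1 or -1 according to the sign of definiteness.\<close>
  have pick: "(\<Sum>k\<in>UNIV. axis j c $ k *\<^sub>R ?L k) = c *\<^sub>R ?L j" for c
    by (simp add: axis_def if_distrib[of "\<lambda>c. c *\<^sub>R _"] cong: if_cong)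
  have "\<exists>u :: real^'m. pos_def_mat (transpose V ** (\<Sum>k\<in>UNIV. u $ k *\<^sub>R ?L k) ** V)"
    using j
  proof
    assume "pos_def_mat (transpose V ** ?L j ** V)"
    then show ?thesis by (intro exI[of _ "axis j 1"]) (simp add: pick)
  next
    assume "neg_def_mat (transpose V ** ?L j ** V)"
    from pos_def_mat_uminus[OF this] have "pos_def_mat (transpose V ** (- ?L j) ** V)"
      by (rule back_subst[of pos_def_mat]) (simp add: matrix_matrix_mult_def sum_negf vec_eq_iff)
    then show ?thesis by (intro exI[of _ "axis j (-1)"]) (simp add: pick)
  qed
  with low V show ?thesis
    unfolding has_matrix_relative_degree_def high by blast
qed

end
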